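(* For any integers $d, r \geq 0$ and real number $t \geq 1$, for any minor-closed class $\mathcal{G}$ of graphs such that every graph in $\mathcal{G}$ has edge density at most $t$, and for every region intersection graph $G$ over $\mathcal{G}$ such that $G$ has maximum density at most $d$, $$\nabla_{r}(G) \leq e\,t\,\big((2r + 2) d + 1\big),$$ where $e$ is the base of the natural logarithm.
   Context: Graphs are finite, simple and undirected. A class of graphs is a collection of graphs closed under isomorphism. A graph $J$ is a minor of a graph $G$ if a graph isomorphic to $J$ can be obtained from $G$ by vertex deletions, edge deletions and edge contractions; a class $\mathcal{G}$ is minor-closed if every minor of every graph in $\mathcal{G}$ is in $\mathcal{G}$. A graph $G$ is a region intersection graph over a graph $H$ if there exists a collection $(A_v \subseteq H : v\in V(G))$ of (non-empty) connected subgraphs of $H$ such that for distinct $u,v\in V(G)$, $uv\in E(G)$ if and only if $V(A_u)\cap V(A_v)\neq\emptyset$. A region intersection graph over a class $\mathcal{G}$ is a region intersection graph over some graph in $\mathcal{G}$. The edge density of a graph $G$ is $|E(G)|/|V(G)|$ if $V(G)\neq\emptyset$, and is $0$ if $V(G)=\emptyset$. The maximum density of $G$ is the maximum edge density of a subgraph of $G$. A model of a graph $J$ in a graph $G$ is a collection $(S_i : i\in V(J))$ of pairwise disjoint non-empty subsets of $V(G)$ such that each induced subgraph $G[S_i]$ is connected and for every edge $ij\in E(J)$ there is an edge of $G$ between $S_i$ and $S_j$. The radius of a connected graph $S$ is the minimum integer $r\geq 0$ such that for some vertex $c\in V(S)$, $\mathrm{dist}_S(c,w)\leq r$ for every $w\in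 V(S)$. The model is $r$-shallow if each $G[S_i]$ has radius at most $r$. $J$ is an $r$-shallow minor of $G$ if there is an $r$-shallow model of $J$ in $G$. $\nabla_r(G)$ is the maximum edge density of an $r$-shallow minor of $G$. *)

theory Defs
  imports "Graph_Theory.Graph_Theory" "HOL-Library.Disjoint_Sets"
begin

text \<open>
  A finite simple undirected graph is a \<^locale>\<open>pair_graph\<close>: a finite, loop-free, symmetric set of
  pairs over a finite vertex set, so each undirected edge is a pair of opposite arcs. The null graph
  is a graph. A class of graphs is represented by the set of its members with vertices in \<^typ>\<open>nat\<close>;
  closure under isomorphism makes this lossless, as every finite graph has such a copy.
\<close>

definition edges :: "'a pair_pre_digraph \<Rightarrow> 'a set set" where
  "edges G = {{u, v} | u v. (u, v) \<in> parcs G}"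

definition graph_class :: "nat pair_pre_digraph set \<Rightarrow> bool" where
  "graph_class \<G> \<longleftrightarrow>
     (\<forall>G\<in>\<G>. pair_graph G) \<and>
     (\<forall>G\<in>\<G>. \<forall>H. pair_graph H \<and> digraph_iso (with_proj G) (with_proj H) \<longrightarrow> H \<in> \<G>)"


subsection \<open>Minors\<close>

definition delete_vertex :: "'a pair_pre_digraph \<Rightarrow> 'a \<Rightarrow> 'a pair_pre_digraph" where
  "delete_vertex G v =
     \<lparr> pverts = pverts G - {v}, parcs = {(a, b) \<in> parcs G. a \<noteq> v \<and> b \<noteq> v} \<rparr>"

definition delete_edge :: "'a pair_pre_digraph \<Rightarrow> 'a \<Rightarrow> 'a \<Rightarrow> 'a pair_pre_digraph" where
  "delete_edge G u v = \<lparr> pverts = pverts G, parcs = parcs G - {(u, v), (v, u)} \<rparr>"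

text \<open>The vertex resulting from the contraction of \<open>uv\<close> is called \<open>u\<close>; loops and parallel edges
  that arise are discarded.\<close>

definition contract_edge :: "'a pair_pre_digraph \<Rightarrow> 'a \<Rightarrow> 'a \<Rightarrow> 'a pair_pre_digraph" where
  "contract_edge G u v =
     (let f = (\<lambda>x. if x = v then u else x) in
      \<lparr> pverts = f ` pverts G,
        parcs = {(f a, f b) | a b. (a, b) \<in> parcs G \<and> f a \<noteq> f b} \<rparr>)"

inductive minor_step :: "'a pair_pre_digraph \<Rightarrow> 'a pair_pre_digraph \<Rightarrow> bool" where
  vertex_deletion: "v \<in> pverts G \<Longrightarrow> minor_step G (delete_vertex G v)"
| edge_deletion: "(u, v) \<in> parcs G \<Longrightarrow> minor_step G (delete_edge G u v)"
| edge_contraction: "(u, v) \<in> parcs G \<Longrightarrow> minor_step G (contract_edge G u v)"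

definition is_minor :: "'b pair_pre_digraph \<Rightarrow> 'a pair_pre_digraph \<Rightarrow> bool" where
  "is_minor J G \<longleftrightarrow> (\<exists>K. minor_step\<^sup>*\<^sup>* G K \<and> digraph_iso (with_proj J) (with_proj K))"

definition minor_closed :: "nat pair_pre_digraph set \<Rightarrow> bool" where
  "minor_closed \<G> \<longleftrightarrow> (\<forall>G\<in>\<G>. \<forall>J. pair_graph J \<and> is_minor J G \<longrightarrow> J \<in> \<G>)"


subsection \<open>Region intersection graphs\<close>

text \<open>\<^const>\<open>Digraph_Component.connected\<close> entails that the vertex set is non-empty.\<close>

definition region_intersection_graph ::
  "'a pair_pre_digraph \<Rightarrow> 'b pair_pre_digraph \<Rightarrow> bool" where
  "region_intersection_graph G H \<longleftrightarrow>
     (\<exists>A :: 'a \<Rightarrow> 'b pair_pre_digraph.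
        (\<forall>v\<in>pverts G. pair_graph (A v) \<and> subgraph (with_proj (A v)) (with_proj H) \<and>
           Digraph_Component.connected (with_proj (A v))) \<and>
        (\<forall>u\<in>pverts G. \<forall>v\<in>pverts G. u \<noteq> v \<longrightarrow>
           ((u, v) \<in> parcs G \<longleftrightarrow> pverts (A u) \<inter> pverts (A v) \<noteq> {})))"

definition region_intersection_graph_over ::
  "'a pair_pre_digraph \<Rightarrow> nat pair_pre_digraph set \<Rightarrow> bool" where
  "region_intersection_graph_over G \<G> \<longleftrightarrow> (\<exists>H\<in>\<G>. region_intersection_graph G H)"


subsection \<open>Density\<close>

definition edge_density :: "'a pair_pre_digraph \<Rightarrow> real" where
  "edge_density G =
     (if pverts G = {} then 0 else real (card (edges G)) / real (card (pverts G)))"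

definition max_density :: "'a pair_pre_digraph \<Rightarrow> real" where
  "max_density G =
     Max {edge_density H | H. pair_graph H \<and> subgraph (with_proj H) (with_proj G)}"


subsection \<open>Shallow minors\<close>

text \<open>With unit weights, \<open>wf_digraph.\<mu>\<close> is the graph distance.\<close>

definition dist_in :: "('a, 'b) pre_digraph \<Rightarrow> 'a \<Rightarrow> 'a \<Rightarrow> ereal" where
  "dist_in G u v = wf_digraph.\<mu> G (\<lambda>_. 1) u v"

text \<open>Meaningful for finite connected graphs only.\<close>

definition radius :: "('a, 'b) pre_digraph \<Rightarrow> nat" where
  "radius G = (LEAST r. \<exists>c\<in>verts G. \<forall>w\<in>verts G. dist_in G c w \<le> ereal (real r))"

definition is_model ::
  "('b \<Rightarrow> 'a set) \<Rightarrow> 'b pair_pre_digraph \<Rightarrow> 'a pair_pre_digraph \<Rightarrow> bool" where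
  "is_model S J G \<longleftrightarrow>
     (\<forall>i\<in>pverts J. S i \<noteq> {} \<and> S i \<subseteq> pverts G) \<and>
     disjoint_family_on S (pverts J) \<and>
     (\<forall>i\<in>pverts J. Digraph_Component.connected (with_proj G \<restriction> S i)) \<and>
     (\<forall>i j. (i, j) \<in> parcs J \<longrightarrow> (\<exists>x\<in>S i. \<exists>y\<in>S j. (x, y) \<in> parcs G))"

definition shallow_model ::
  "nat \<Rightarrow> ('b \<Rightarrow> 'a set) \<Rightarrow> 'b pair_pre_digraph \<Rightarrow> 'a pair_pre_digraph \<Rightarrow> bool" where
  "shallow_model r S J G \<longleftrightarrow>
     is_model S J G \<and> (\<forall>i\<in>pverts J. radius (with_proj G \<restriction> S i) \<le> r)"

definition shallow_minor :: "nat \<Rightarrow> 'b pair_pre_digraph \<Rightarrow> 'a pair_pre_digraph \<Rightarrow> bool" where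
  "shallow_minor r J G \<longleftrightarrow> (\<exists>S. shallow_model r S J G)"

text \<open>Up to isomorphism, every shallow minor has its vertices in \<^typ>\<open>nat\<close>.\<close>

definition nabla :: "nat \<Rightarrow> 'a pair_pre_digraph \<Rightarrow> real" where
  "nabla r G =
     Max {edge_density J | J :: nat pair_pre_digraph. pair_graph J \<and> shallow_minor r J G}"


subsection \<open>The maxima are attained\<close>

lemma edges_subset_Pow: "pair_graph G \<Longrightarrow> edges G \<subseteq> Pow (pverts G)"
  using pair_graph.axioms(1)[THEN pair_digraph.axioms(1), THEN pair_fin_digraph.axioms(1)]
  by (fastforce simp: edges_def pair_wf_digraph_def)

lemma finite_edge_densities:
  assumes "\<And>H. P H \<Longrightarrow> pair_graph H \<and> card (pverts H) \<le> n"
  shows "finite {edge_density H | H. P H}"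
proof (rule finite_subset)
  show "{edge_density H | H. P H} \<subseteq> (\<lambda>(m, k). real m / real k) ` ({..2 ^ n} \<times> {..n})"
  proof clarify
    fix H assume "P H"
    then have G: "pair_graph H" and c: "card (pverts H) \<le> n" using assms by auto
    have fin: "finite (pverts H)"
      using G by (simp add: pair_graph_def pair_digraph_def pair_fin_digraph_def
          pair_fin_digraph_axioms_def)
    have "card (edges H) \<le> card (Pow (pverts H))"
      using edges_subset_Pow[OF G] fin by (intro card_mono) auto
    also have "\<dots> \<le> 2 ^ n" using fin c by (simp add: card_Pow)
    finally have m: "card (edges H) \<le> 2 ^ n" .
    have "edge_density H = real (card (edges H)) / real (card (pverts H))"
      by (simp add: edge_density_def)
    then show "edge_density H \<in> (\<lambda>(m, k). real m / real k) ` ({..2 ^ n} \<times> {..n})"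
      using m c by (intro image_eqI[where x = "(card (edges H), card (pverts H))"]) auto
  qed
qed simp

lemma pair_graph_null: "pair_graph \<lparr> pverts = {}, parcs = {} \<rparr>"
  by unfold_locales (auto simp: symmetric_def arcs_ends_def with_proj_def sym_def)

lemma max_density_attained:
  assumes "pair_graph G"
  shows "max_density G \<in> {edge_density H | H. pair_graph H \<and> subgraph (with_proj H) (with_proj G)}"
    (is "_ \<in> ?D")
proof -
  have "finite (pverts G)"
    using assms by (simp add: pair_graph_def pair_digraph_def pair_fin_digraph_def
        pair_fin_digraph_axioms_def)
  then have "finite ?D"
    by (intro finite_edge_densities[where n = "card (pverts G)"])
      (auto simp: subgraph_def intro: card_mono)
  moreover have "subgraph (with_proj G) (with_proj G)"
    using assms by (auto simp: subgraph_def compatible_def pair_graph_def pair_digraph_def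
        pair_fin_digraph_def wf_digraph_wp_iff)
  then have "?D \<noteq> {}" using assms by blast
  ultimately show ?thesis unfolding max_density_def by (rule Max_in)
qed

lemma nabla_attained:
  assumes "pair_graph G"
  shows "nabla r G \<in>
    {edge_density J | J :: nat pair_pre_digraph. pair_graph J \<and> shallow_minor r J G}"
    (is "_ \<in> ?D")
proof -
  have fin: "finite (pverts G)"
    using assms by (simp add: pair_graph_def pair_digraph_def pair_fin_digraph_def
        pair_fin_digraph_axioms_def)
  have "card (pverts J) \<le> card (pverts G)" if J: "shallow_minor r J G"
    for J :: "nat pair_pre_digraph"
  proof -
    from J obtain S where ne: "\<And>i. i \<in> pverts J \<Longrightarrow> S i \<noteq> {} \<and> S i \<subseteq> pverts G"
      and disj: "disjoint_family_on S (pverts J)"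
      by (auto simp: shallow_minor_def shallow_model_def is_model_def)
    define f where "f i = (SOME x. x \<in> S i)" for i
    have f: "f i \<in> S i" if "i \<in> pverts J" for i
      using ne[OF that] by (auto simp: f_def some_in_eq)
    have "inj_on f (pverts J)"
    proof (rule inj_onI, rule ccontr)
      fix i j assume ij: "i \<in> pverts J" "j \<in> pverts J" "f i = f j" "i \<noteq> j"
      then have "f i \<in> S i \<inter> S j" using f[of i] f[of j] by simp
      then show False using disj ij by (auto simp: disjoint_family_on_def)
    qed
    moreover have "f ` pverts J \<subseteq> pverts G" using f ne by blast
    ultimately show ?thesis using fin by (rule card_inj_on_le)
  qed
  then have "finite ?D"
    by (intro finite_edge_densities[where n = "card (pverts G)"]) auto
  moreover have "shallow_minor r (\<lparr> pverts = {}, parcs = {} \<rparr> :: nat pair_pre_digraph) G"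
    by (auto simp: shallow_minor_def shallow_model_def is_model_def disjoint_family_on_def)
  then have "?D \<noteq> {}" using pair_graph_null by blast
  ultimately show ?thesis unfolding nabla_def by (rule Max_in)
qed

end

theory Submission
  imports Defs
begin

text \<open>
  Let \<open>J\<close> be an \<open>r\<close>-shallow minor of \<open>G\<close> with branch sets \<open>S i\<close>, and let \<open>G\<close> be the region intersection
  graph over \<open>H\<close> of the regions \<open>A v\<close>. By Hall's theorem \<open>G\<close> has an orientation with out-degrees at
  most \<open>d\<close>. Each edge \<open>ij\<close> of \<open>J\<close> is realised by at most \<open>2r + 2\<close> vertices of \<open>G\<close>, joining a centre of
  \<open>S i\<close> to a centre of \<open>S j\<close>; their out-neighbours lie in a set \<open>bad i j\<close> of at most \<open>(2r + 2) d\<close> further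
  branch sets. Choose a random set \<open>X\<close> of vertices of \<open>J\<close>, each with probability \<open>1 / ((2r + 2) d + 1)\<close>,
  and keep the edges \<open>ij\<close> with \<open>i, j \<in> X\<close> and no bad index in \<open>X\<close>. The kept graph has at most \<open>t |X|\<close>
  edges, and comparing expectations gives the bound.

  For the sparsity of the kept graph, vertices of degree at most one may be removed because \<open>t \<ge> 1\<close>; what
  remains is a minor of \<open>H\<close>. Indeed, if the regions used by \<open>i\<close> for the edge \<open>ia\<close> and by \<open>j\<close> for
  the edge \<open>jb\<close> meet, then some vertex of \<open>G\<close> on one side has an out-neighbour on the other, so \<open>a = j\<close>
  or \<open>b = i\<close>. For \<open>i < j\<close> the route from \<open>i\<close> is moreover cut off at its first point in the territory
  of \<open>j\<close>. This lets the overlaps be resolved greedily, in increasing order of the vertices of \<open>J\<close>.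
\<close>

section \<open>Connected vertex sets\<close>

text \<open>Connectivity is phrased for a relation and a vertex set, so that it applies alike to
  \<open>G\<close>, to the host graph and to its contractions. The empty set counts as connected;
  non-emptiness is always stated separately.\<close>

definition connected_in :: "'a rel \<Rightarrow> 'a set \<Rightarrow> bool" where
  "connected_in E A \<longleftrightarrow> (\<forall>x\<in>A. \<forall>y\<in>A. (x, y) \<in> (Restr E A)\<^sup>*)"

text \<open>If \<open>h\<close> lies outside \<open>A\<close>, this is just \<open>{h}\<close>. The
  root thus stays in its component even when the set removed from a region contains it.\<close>

definition component :: "'a rel \<Rightarrow> 'a set \<Rightarrow> 'a \<Rightarrow> 'a set" where
  "component E A h = (Restr E A)\<^sup>* `` {h}"

lemma component_self [simp]: "h \<in> component E A h"
  by (simp add: component_def)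

lemma component_subset: "component E A h \<subseteq> insert h A"
  by (auto simp: component_def elim: rtranclE)

lemma connected_in_component_eq:
  assumes "connected_in E A" "h \<in> A"
  shows "component E A h = A"
proof
  show "component E A h \<subseteq> A" using component_subset[of E A h] assms(2) by blast
  show "A \<subseteq> component E A h" using assms by (auto simp: connected_in_def component_def)
qed

lemma connected_in_star:
  assumes "sym E" "\<And>y. y \<in> A \<Longrightarrow> (h, y) \<in> (Restr E A)\<^sup>*"
  shows "connected_in E A"
proof -
  have "sym ((Restr E A)\<^sup>*)"
    using assms(1) by (intro sym_rtrancl) (auto simp: sym_def)
  then show ?thesis
    using assms(2) unfolding connected_in_def by (meson rtrancl_trans symD)
qed

lemma rtrancl_Restr_mono:
  assumes "(x, y) \<in> (Restr E A)\<^sup>*" "A \<subseteq> B"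
  shows "(x, y) \<in> (Restr E B)\<^sup>*"
proof -
  have "Restr E A \<subseteq> Restr E B" using assms(2) by blast
  then show ?thesis using assms(1) rtrancl_mono by blast
qed

lemma connected_in_UN:
  assumes "sym E" "\<And>i. i \<in> I \<Longrightarrow> connected_in E (C i)" "\<And>i. i \<in> I \<Longrightarrow> h \<in> C i"
  shows "connected_in E (\<Union>i\<in>I. C i)"
proof (rule connected_in_star[OF assms(1)])
  fix y assume "y \<in> (\<Union>i\<in>I. C i)"
  then obtain i where i: "i \<in> I" "y \<in> C i" by blast
  then have "(h, y) \<in> (Restr E (C i))\<^sup>*" using assms(2,3) by (auto simp: connected_in_def)
  then show "(h, y) \<in> (Restr E (\<Union>i\<in>I. C i))\<^sup>*"
    by (rule rtrancl_Restr_mono) (use i in blast)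
qed

lemma connected_in_component:
  assumes "sym E" shows "connected_in E (component E A h)"
proof (rule connected_in_star[OF assms])
  fix y assume "y \<in> component E A h"
  then have "(h, y) \<in> (Restr E A)\<^sup>*" by (simp add: component_def)
  then show "(h, y) \<in> (Restr E (component E A h))\<^sup>*"
  proof (induction rule: rtrancl_induct)
    case (step y z)
    have "y \<in> component E A h" "z \<in> component E A h"
      using step.hyps rtrancl_into_rtrancl[OF step.hyps] by (simp_all add: component_def)
    then have "(y, z) \<in> Restr E (component E A h)" using step.hyps(2) by blast
    then show ?case using step.IH by (rule rtrancl_into_rtrancl[rotated])
  qed simp
qed

text \<open>Follow a walk from \<open>h\<close> to \<open>y\<close> inside \<open>A\<close> up to
  its first vertex in \<open>B\<close>: everything before that vertex lies in the component of
  \<open>h\<close> in \<open>A - B\<close>. The induction carries the alternative "already crossed,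
  or still in that component".\<close>

lemma component_exit:
  assumes "(h, y) \<in> (Restr E A)\<^sup>*" "h \<notin> B" "y \<in> B"
  shows "\<exists>a\<in>component E (A - B) h. \<exists>b\<in>A \<inter> B. (a, b) \<in> E"
proof -
  have "(\<exists>a\<in>component E (A - B) h. \<exists>b\<in>A \<inter> B. (a, b) \<in> E) \<or>
      y \<notin> B \<and> y \<in> component E (A - B) h"
    using assms(1)
  proof (induction rule: rtrancl_induct)
    case base
    then show ?case using assms(2) by simp
  next
    case (step y z)
    show ?case
    proof (cases "y \<notin> B \<and> y \<in> component E (A - B) h")
      case True
      then show ?thesis
      proof (cases "z \<in> B")
        case True
        then show ?thesis using \<open>y \<notin> B \<and> y \<in> component E (A - B) h\<close> step.hyps by blast
      next
        case False
        then have "(y, z) \<in> Restr E (A - B)" using True step.hyps by blast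
        then show ?thesis using True False by (auto simp: component_def intro: rtrancl_into_rtrancl)
      qed
    qed (use step.IH in blast)
  qed
  then show ?thesis using assms(3) by blast
qed

text \<open>Steps of a walk that \<open>f\<close> collapses are simply skipped. This is what keeps
  branch sets connected under edge contraction.\<close>

lemma connected_in_image:
  assumes "connected_in E A"
    and "\<And>x y. x \<in> A \<Longrightarrow> y \<in> A \<Longrightarrow> (x, y) \<in> E \<Longrightarrow> f x \<noteq> f y \<Longrightarrow> (f x, f y) \<in> E'"
  shows "connected_in E' (f ` A)"
proof -
  have "(f x, f y) \<in> (Restr E' (f ` A))\<^sup>*" if "(x, y) \<in> (Restr E A)\<^sup>*" for x y
    using that
  proof (induction rule: rtrancl_induct)
    case (step y z)
    then show ?case
      using assms(2)[of y z] by (cases "f y = f z") (auto intro: rtrancl_into_rtrancl)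
  qed simp
  then show ?thesis using assms(1) by (auto simp: connected_in_def)
qed

section \<open>Counting the edges of a minor\<close>

lemma pair_graph_iff:
  "pair_graph G \<longleftrightarrow> finite (pverts G) \<and> parcs G \<subseteq> pverts G \<times> pverts G \<and> sym (parcs G) \<and> irrefl (parcs G)"
    (is "_ \<longleftrightarrow> ?R")
proof
  assume "pair_graph G"
  then interpret pair_graph G .
  have "irrefl (parcs G)" using pair_no_loops by (metis fst_conv irreflI snd_conv)
  then show ?R
    using pair_finite_verts pair_sym_arcs in_arcsD1 in_arcsD2
    by (auto simp: symmetric_def)
next
  assume R: ?R
  have "finite (pverts G \<times> pverts G)" using R by blast
  then have fin: "finite (parcs G)" using R finite_subset by blast
  show "pair_graph G"
  proof
    fix e assume "e \<in> parcs G"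
    then show "fst e \<in> pverts G" "snd e \<in> pverts G" "fst e \<noteq> snd e"
      using R by (cases e; force simp: irrefl_def)+
  qed (use R fin in \<open>simp_all add: symmetric_def\<close>)
qed

lemma pair_graph_minor_step:
  assumes "pair_graph G" "minor_step G K"
  shows "pair_graph K"
proof -
  have fin: "finite (pverts G)" and sub: "parcs G \<subseteq> pverts G \<times> pverts G"
    and s: "sym (parcs G)" and irr: "irrefl (parcs G)"
    using assms(1) by (auto simp: pair_graph_iff)
  from assms(2) show ?thesis
  proof cases
    case (vertex_deletion v)
    have K: "pverts K = pverts G - {v}" "parcs K = {(a, b) \<in> parcs G. a \<noteq> v \<and> b \<noteq> v}"
      by (simp_all add: vertex_deletion(1) delete_vertex_def)
    have "sym (parcs K)" unfolding K using s by (blast intro: symI dest: symD)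
    moreover have "irrefl (parcs K)" unfolding K using irr by (auto simp: irrefl_def)
    ultimately show ?thesis using fin sub unfolding pair_graph_iff K by blast
  next
    case (edge_deletion u v)
    have K: "pverts K = pverts G" "parcs K = parcs G - {(u, v), (v, u)}"
      by (simp_all add: edge_deletion(1) delete_edge_def)
    have "sym (parcs K)" unfolding K using s by (blast intro: symI dest: symD)
    moreover have "irrefl (parcs K)" unfolding K using irr by (auto simp: irrefl_def)
    ultimately show ?thesis using fin sub unfolding pair_graph_iff K by blast
  next
    case (edge_contraction u v)
    define f where "f x = (if x = v then u else x)" for x
    have K: "pverts K = f ` pverts G"
      "parcs K = {(f a, f b) | a b. (a, b) \<in> parcs G \<and> f a \<noteq> f b}"
      by (simp_all add: edge_contraction(1) contract_edge_def Let_def f_def[abs_def])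
    have "sym (parcs K)"
    proof (rule symI)
      fix x y assume "(x, y) \<in> parcs K"
      then obtain a b where ab: "x = f a" "y = f b" "(a, b) \<in> parcs G" "f a \<noteq> f b"
        unfolding K by blast
      have "(b, a) \<in> parcs G" by (rule symD[OF s ab(3)])
      then show "(y, x) \<in> parcs K" unfolding K ab(1,2)
        using ab(4) by (intro CollectI exI[of _ b] exI[of _ a]) simp
    qed
    moreover have "irrefl (parcs K)" unfolding K irrefl_def by blast
    ultimately show ?thesis using fin sub unfolding pair_graph_iff K by blast
  qed
qed

lemma minor_step_in_class:
  assumes "graph_class \<G>" "minor_closed \<G>" "H \<in> \<G>" "minor_step H K"
  shows "K \<in> \<G>"
proof -
  have K: "pair_graph K"
    using assms(1,3,4) pair_graph_minor_step unfolding graph_class_def by blast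
  then have "wf_digraph (with_proj K)"
    by (auto simp: pair_graph_iff wf_digraph_wp_iff pair_wf_digraph_def)
  \<comment> \<open>Minors are taken up to isomorphism, so the identity isomorphism of
    \<open>K\<close> has to be exhibited.\<close>
  then have "pre_digraph.digraph_isomorphism (with_proj K)
      \<lparr> iso_verts = id, iso_arcs = id, iso_head = snd, iso_tail = fst \<rparr>"
    by (simp add: pre_digraph.digraph_isomorphism_def)
  moreover have "with_proj K =
      app_iso \<lparr> iso_verts = id, iso_arcs = id, iso_head = snd, iso_tail = fst \<rparr> (with_proj K)"
    by (simp add: app_iso_def with_proj_def)
  ultimately have "digraph_iso (with_proj K) (with_proj K)"
    unfolding digraph_iso_def by blast
  then have "is_minor K H" using assms(4) by (auto simp: is_minor_def)
  then show ?thesis using assms(2,3) K unfolding minor_closed_def by blast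
qed

text \<open>Delete vertices outside the branch sets and contract edges inside them, by induction on
  the number of vertices of the host. When neither is possible, every \<open>W i\<close> is a single
  vertex, \<open>F\<close> injects into the edges of the host and \<open>Y\<close> is in bijection
  with its vertices, so the density bound applies. The condition \<open>i < j\<close> makes each
  edge be counted once.\<close>

lemma card_model_edges_le:
  fixes Y :: "'b::linorder set" and W :: "'b \<Rightarrow> nat set"
  assumes "graph_class \<G>" "minor_closed \<G>" "\<forall>H\<in>\<G>. edge_density H \<le> t"
  assumes "H \<in> \<G>" "finite Y"
    and "\<And>i. i \<in> Y \<Longrightarrow> W i \<noteq> {} \<and> W i \<subseteq> pverts H \<and> connected_in (parcs H) (W i)"
    and "disjoint_family_on W Y"
    and "\<And>i j. (i, j) \<in> F \<Longrightarrow> i \<in> Y \<and> j \<in> Y \<and> i < j \<and> (\<exists>x\<in>W i. \<exists>y\<in>W j. (x, y) \<in> parcs H)"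
  shows "real (card F) \<le> t * real (card Y)"
  using assms(4,6-)
proof (induction "card (pverts H)" arbitrary: H W rule: less_induct)
  case less
  note W = less.prems(2) and disj = less.prems(3) and F = less.prems(4)
  have H: "pair_graph H" using less.prems(1) assms(1) by (auto simp: graph_class_def)
  then have fin: "finite (pverts H)" and sub: "parcs H \<subseteq> pverts H \<times> pverts H"
    by (auto simp: pair_graph_iff)
  consider (outside) v where "v \<in> pverts H" "v \<notin> (\<Union>i\<in>Y. W i)"
    | (inside) i u v where "i \<in> Y" "u \<in> W i" "v \<in> W i" "(u, v) \<in> parcs H"
    | (single) "pverts H \<subseteq> (\<Union>i\<in>Y. W i)" "\<And>i u v. i \<in> Y \<Longrightarrow> u \<in> W i \<Longrightarrow> v \<in> W i \<Longrightarrow> (u, v) \<notin> parcs H"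
    by blast
  then show ?case
  proof cases
    case outside
    let ?K = "delete_vertex H v"
    have "?K \<in> \<G>"
      using minor_step_in_class[OF assms(1,2) less.prems(1)] outside(1) minor_step.vertex_deletion
      by metis
    moreover have "card (pverts ?K) < card (pverts H)"
      using fin outside(1) by (simp add: delete_vertex_def del: card_Diff_insert) (rule card_Diff1_less)
    moreover have "W i \<noteq> {} \<and> W i \<subseteq> pverts ?K \<and> connected_in (parcs ?K) (W i)" if "i \<in> Y" for i
    proof -
      have "Restr (parcs ?K) (W i) = Restr (parcs H) (W i)"
        using that outside(2) by (auto simp: delete_vertex_def)
      then show ?thesis
        using W[OF that] that outside(2) by (auto simp: delete_vertex_def connected_in_def)
    qed
    moreover have "i \<in> Y \<and> j \<in> Y \<and> i < j \<and> (\<exists>x\<in>W i. \<exists>y\<in>W j. (x, y) \<in> parcs ?K)" if "(i, j) \<in> F" for i j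
      using F[OF that] outside(2) by (fastforce simp: delete_vertex_def)
    ultimately show ?thesis using less.hyps[of ?K W] disj by blast
  next
    case inside
    define f where "f x = (if x = v then u else x)" for x
    let ?K = "contract_edge H u v"
    have uv: "u \<noteq> v" "u \<in> pverts H" "v \<in> pverts H"
      using inside(4) H by (auto simp: pair_graph_iff irrefl_def)
    have K: "pverts ?K = f ` pverts H"
      "parcs ?K = {(f a, f b) | a b. (a, b) \<in> parcs H \<and> f a \<noteq> f b}"
      by (simp_all add: contract_edge_def Let_def f_def[abs_def])
    have "?K \<in> \<G>"
      using minor_step_in_class[OF assms(1,2) less.prems(1)] inside(4) minor_step.edge_contraction
      by metis
    moreover have "pverts ?K = pverts H - {v}" using uv by (auto simp: K f_def)
    then have "card (pverts ?K) < card (pverts H)"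
      using fin uv card_Diff1_less by metis
    \<comment> \<open>The only two vertices that \<open>f\<close> identifies both lie in
      \<open>W i\<close>, so different branch sets stay disjoint.\<close>
    moreover have sep: "f x \<noteq> f y" if "j \<in> Y" "k \<in> Y" "j \<noteq> k" "x \<in> W j" "y \<in> W k" for j k x y
    proof
      assume eq: "f x = f y"
      have "W j \<inter> W k = {}" "W i \<inter> W j = {} \<or> i = j" "W i \<inter> W k = {} \<or> i = k"
        using disj that inside(1) by (auto simp: disjoint_family_on_def)
      then show False
        using eq that inside(1-3) by (auto simp: f_def split: if_splits)
    qed
    then have "disjoint_family_on (\<lambda>j. f ` W j) Y"
      by (fastforce simp: disjoint_family_on_def)
    moreover have "f ` W j \<noteq> {} \<and> f ` W j \<subseteq> pverts ?K \<and> connected_in (parcs ?K) (f ` W j)"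
      if "j \<in> Y" for j
      using W[OF that] connected_in_image[of "parcs H" "W j" f "parcs ?K"] by (auto simp: K)
    moreover have "j \<in> Y \<and> k \<in> Y \<and> j < k \<and> (\<exists>x\<in>f ` W j. \<exists>y\<in>f ` W k. (x, y) \<in> parcs ?K)"
      if "(j, k) \<in> F" for j k
      using F[OF that] sep[of j k] by (fastforce simp: K)
    ultimately show ?thesis using less.hyps[of ?K "\<lambda>j. f ` W j"] by blast
  next
    case single
    have "\<exists>x. W i = {x}" if i: "i \<in> Y" for i
    proof -
      have "Restr (parcs H) (W i) = {}" using single(2)[OF i] by blast
      then have "x = y" if "x \<in> W i" "y \<in> W i" for x y
        using W[OF i] that by (auto simp: connected_in_def)
      then show ?thesis using W[OF i] by blast
    qed
    then obtain w where w: "\<And>i. i \<in> Y \<Longrightarrow> W i = {w i}" by metis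
    have inj: "inj_on w Y"
      using disj w by (fastforce simp: disjoint_family_on_def inj_on_def)
    have "pverts H = w ` Y" using single(1) W w by auto
    then have cY: "card (pverts H) = card Y" using inj by (simp add: card_image)
    have "inj_on (\<lambda>(i, j). {w i, w j}) F"
    proof (rule inj_onI, clarify)
      fix i j i' j' assume a: "(i, j) \<in> F" "(i', j') \<in> F" "{w i, w j} = {w i', w j'}"
      then have *: "i \<in> Y" "j \<in> Y" "i < j" "i' \<in> Y" "j' \<in> Y" "i' < j'" using F by blast+
      then have "i = i' \<and> j = j' \<or> i = j' \<and> j = i'"
        using a(3) inj by (auto simp: doubleton_eq_iff inj_on_def)
      then show "i = i' \<and> j = j'" using * by auto
    qed
    moreover have "{w i, w j} \<in> edges H" if "(i, j) \<in> F" for i j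
    proof -
      have "(w i, w j) \<in> parcs H" using F[OF that] w by auto
      then show ?thesis by (auto simp: edges_def)
    qed
    then have "(\<lambda>(i, j). {w i, w j}) ` F \<subseteq> edges H" by auto
    moreover have "finite (edges H)"
      using edges_subset_Pow[OF H] fin by (meson finite_Pow_iff finite_subset)
    ultimately have "card F \<le> card (edges H)" by (rule card_inj_on_le)
    also have "real (card (edges H)) \<le> t * real (card Y)"
    proof (cases "pverts H = {}")
      case True
      then have "edges H = {}" using sub by (auto simp: edges_def)
      then show ?thesis using cY True by simp
    next
      case False
      then have "real (card (edges H)) / real (card (pverts H)) \<le> t"
        using assms(3) less.prems(1) by (auto simp: edge_density_def split: if_splits)
      moreover have "card (pverts H) > 0" using False fin by (simp add: card_gt_0_iff)
      ultimately show ?thesis by (simp add: cY pos_divide_le_eq)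
    qed
    finally show ?thesis by simp
  qed
qed

section \<open>Disentangling overlapping regions\<close>

text \<open>
  \<open>R i j\<close> is the part of the host graph that \<open>i\<close> may use for its edge to \<open>j\<close>, \<open>B i\<close> the territory of \<open>i\<close>
  and \<open>h i\<close> its root.
\<close>

locale region_system =
  fixes E :: "'v rel" and X :: "nat set" and N :: "nat \<Rightarrow> nat set"
    and R :: "nat \<Rightarrow> nat \<Rightarrow> 'v set" and B :: "nat \<Rightarrow> 'v set" and h :: "nat \<Rightarrow> 'v"
  assumes sym_E: "sym E"
    and N_sub: "i \<in> X \<Longrightarrow> N i \<subseteq> X - {i}"
    and N_sym: "i \<in> X \<Longrightarrow> j \<in> N i \<Longrightarrow> i \<in> N j"
    and other_neighbour: "i \<in> X \<Longrightarrow> \<exists>a\<in>N i. a \<noteq> j"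
    and connected_R: "i \<in> X \<Longrightarrow> j \<in> N i \<Longrightarrow> connected_in E (R i j)"
    and h_in_R: "i \<in> X \<Longrightarrow> j \<in> N i \<Longrightarrow> h i \<in> R i j"
    and R_sub: "i \<in> X \<Longrightarrow> j \<in> N i \<Longrightarrow> R i j \<subseteq> B i"
    and contact: "i \<in> X \<Longrightarrow> j \<in> N i \<Longrightarrow> i < j \<Longrightarrow>
      \<exists>x\<in>R i j \<inter> R j i. x = h i \<or> (\<exists>z\<in>component E (R i j - B j) (h i). (z, x) \<in> E)"
    and meet: "i \<in> X \<Longrightarrow> j \<in> X \<Longrightarrow> i \<noteq> j \<Longrightarrow> a \<in> N i \<Longrightarrow> b \<in> N j \<Longrightarrow>
      R i a \<inter> R j b \<noteq> {} \<Longrightarrow> a = j \<or> b = i"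
begin

text \<open>
  Towards a larger \<open>j\<close>, vertex \<open>i\<close> stops before entering the territory of \<open>j\<close>; towards a smaller \<open>j\<close>, it
  stops only before what \<open>j\<close> has actually taken.
\<close>

function branch_set :: "nat \<Rightarrow> 'v set" where
  "branch_set i = insert (h i)
     ((\<Union>j\<in>{j \<in> N i. i < j}. component E (R i j - B j) (h i)) \<union>
      (\<Union>j\<in>{j \<in> N i. j < i}. component E (R i j - branch_set j) (h i)))"
  by auto
termination by (relation "measure id") auto

declare branch_set.simps [simp del]

lemma branch_setE:
  assumes "y \<in> branch_set i"
  obtains "y = h i"
    | a where "a \<in> N i" "i < a" "y \<in> R i a" "y \<notin> B a"
    | a where "a \<in> N i" "a < i" "y \<in> R i a" "y \<notin> branch_set a"
  using assms component_subset[of E _ "h i"] unfolding branch_set.simps[of i] by blast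

lemma h_in_branch_set: "h i \<in> branch_set i"
  by (subst branch_set.simps) simp

lemma branch_set_subset: "i \<in> X \<Longrightarrow> branch_set i \<subseteq> B i"
  using other_neighbour[of i] h_in_R[of i] R_sub[of i] by (blast elim: branch_setE)

text \<open>Here degree at least two enters. Since \<open>h i\<close> lies in \<open>R i a\<close>
  for some neighbour \<open>a\<close> other than \<open>j\<close>, \<open>meet\<close> shows that
  \<open>j\<close> can reach \<open>h i\<close> only through \<open>R j i\<close>; but there
  \<open>j\<close> stops before \<open>B i\<close> or before \<open>branch_set i\<close>, and both
  contain \<open>h i\<close>.\<close>

lemma h_notin_branch_set:
  assumes ij: "i \<in> X" "j \<in> X" "i \<noteq> j"
  shows "h i \<notin> branch_set j"
proof
  obtain a where a: "a \<in> N i" "a \<noteq> j" using other_neighbour ij by blast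
  have hi: "h i \<in> R i a" using h_in_R ij(1) a(1) by blast
  have only: "b = i" if "b \<in> N j" "h i \<in> R j b" for b
    using meet[OF ij a(1) that(1)] hi that(2) a(2) by blast
  assume "h i \<in> branch_set j"
  then show False
  proof (cases rule: branch_setE)
    case 1
    obtain b where b: "b \<in> N j" "b \<noteq> i" using other_neighbour ij by blast
    then show False using only[OF b(1)] h_in_R ij(2) 1 by metis
  next
    case (2 b)
    then show False using only[of b] R_sub[OF ij(1) a(1)] hi by blast
  next
    case (3 b)
    then show False using only[of b] h_in_branch_set by blast
  qed
qed

text \<open>A common point lies in some \<open>R i a\<close> and some \<open>R j b\<close>, so
  \<open>a = j\<close> or \<open>b = i\<close>. In the first case \<open>i\<close> has stopped
  before \<open>B j\<close>, which contains \<open>R j b\<close>; in the second \<open>j\<close> has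
  stopped before \<open>branch_set i\<close>.\<close>

lemma branch_set_disjoint:
  assumes ij: "i \<in> X" "j \<in> X" "i < j"
  shows "branch_set i \<inter> branch_set j = {}"
proof (rule ccontr)
  assume "branch_set i \<inter> branch_set j \<noteq> {}"
  then obtain y where y: "y \<in> branch_set i" "y \<in> branch_set j" by blast
  have nh: "y \<noteq> h i" "y \<noteq> h j" using y h_notin_branch_set ij by force+
  obtain a where a: "a \<in> N i" "y \<in> R i a" "i < a \<Longrightarrow> y \<notin> B a" "a \<noteq> i"
    using y(1) nh by (cases rule: branch_setE) auto
  obtain b where b: "b \<in> N j" "y \<in> R j b" "b < j \<Longrightarrow> y \<notin> branch_set b"
    using y(2) nh by (cases rule: branch_setE) auto
  have "a = j \<or> b = i" using meet[OF ij(1,2) _ a(1) b(1)] a(2) b(2) ij(3) by blast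
  then show False using a(3) b ij R_sub y(1) by blast
qed

lemma connected_in_branch_set: "connected_in E (branch_set i)"
proof -
  \<comment> \<open>A family of connected sets that all contain \<open>h i\<close> and together make
    up the branch set.\<close>
  define K where "K = insert {h i}
    ((\<lambda>j. component E (R i j - B j) (h i)) ` {j \<in> N i. i < j} \<union>
     (\<lambda>j. component E (R i j - branch_set j) (h i)) ` {j \<in> N i. j < i})"
  have "branch_set i = (\<Union>C\<in>K. C)"
    unfolding K_def by (subst branch_set.simps) auto
  moreover have "connected_in E C \<and> h i \<in> C" if "C \<in> K" for C
    using that connected_in_component[OF sym_E] by (auto simp: K_def connected_in_def[of _ "{_}"])
  ultimately show ?thesis using connected_in_UN[OF sym_E, of K "\<lambda>C. C" "h i"] by simp
qed

text \<open>If \<open>R j i\<close> misses \<open>branch_set i\<close>, then \<open>j\<close> keeps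
  all of \<open>R j i\<close>, including the contact point, whose predecessor \<open>z\<close>
  belongs to \<open>i\<close>. Otherwise a walk from \<open>h j\<close> inside \<open>R j i\<close>
  enters \<open>branch_set i\<close>, and the part before the entry belongs to
  \<open>j\<close>.\<close>

lemma branch_set_adjacent:
  assumes i: "i \<in> X" "j \<in> N i" "i < j"
  shows "\<exists>x\<in>branch_set i. \<exists>y\<in>branch_set j. (x, y) \<in> E"
proof -
  have j: "j \<in> X" "i \<in> N j" "i \<noteq> j" using i N_sub N_sym by blast+
  obtain x where x: "x \<in> R i j" "x \<in> R j i"
    "x = h i \<or> (\<exists>z\<in>component E (R i j - B j) (h i). (z, x) \<in> E)"
    using contact[OF i] by blast
  have Ci: "component E (R i j - B j) (h i) \<subseteq> branch_set i"
    using i by (subst branch_set.simps) blast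
  have Cj: "component E (R j i - branch_set i) (h j) \<subseteq> branch_set j"
    using i j by (subst branch_set.simps) blast
  have hj: "h j \<notin> branch_set i" "h j \<in> R j i"
    using h_notin_branch_set h_in_R i j by blast+
  have con: "connected_in E (R j i)" using connected_R j by blast
  show ?thesis
  proof (cases "R j i \<inter> branch_set i = {}")
    case True
    then have "R j i - branch_set i = R j i" by blast
    then have "x \<in> branch_set j"
      using Cj connected_in_component_eq[OF con hj(2)] x(2) by auto
    moreover have "x \<noteq> h i" using True x(2) h_in_branch_set by blast
    ultimately show ?thesis using x(3) Ci by blast
  next
    case False
    then obtain y where y: "y \<in> R j i" "y \<in> branch_set i" by blast
    then have "(h j, y) \<in> (Restr E (R j i))\<^sup>*" using con hj by (auto simp: connected_in_def)
    from component_exit[OF this hj(1) y(2)] show ?thesis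
      using Cj sym_E by (blast dest: symD)
  qed
qed

end

section \<open>Removing vertices of degree at most one\<close>

definition neighbours :: "'a rel \<Rightarrow> 'a \<Rightarrow> 'a set" where
  "neighbours F i = {j. (i, j) \<in> F \<or> (j, i) \<in> F}"

text \<open>Removing a vertex of degree at most one loses at most one edge, which
  \<open>t \<ge> 1\<close> pays for, and the hypotheses on the regions pass to the remaining edges.
  Once all degrees are at least two, the greedy branch sets form a model in
  \<open>H\<close>.\<close>

lemma card_region_edges_le:
  fixes F :: "nat rel" and R :: "nat \<Rightarrow> nat \<Rightarrow> nat set"
  assumes \<G>: "graph_class \<G>" "minor_closed \<G>" "\<forall>H\<in>\<G>. edge_density H \<le> t" and t: "t \<ge> 1"
    and H: "H \<in> \<G>" and B_sub: "\<And>i. B i \<subseteq> pverts H"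
    and "finite Y" "\<And>i j. (i, j) \<in> F \<Longrightarrow> i \<in> Y \<and> j \<in> Y \<and> i < j"
    and "\<And>i j. j \<in> neighbours F i \<Longrightarrow>
      connected_in (parcs H) (R i j) \<and> h i \<in> R i j \<and> R i j \<subseteq> B i"
    and "\<And>i j. (i, j) \<in> F \<Longrightarrow> \<exists>x\<in>R i j \<inter> R j i. x = h i \<or>
      (\<exists>z\<in>component (parcs H) (R i j - B j) (h i). (z, x) \<in> parcs H)"
    and "\<And>i j a b. i \<noteq> j \<Longrightarrow> a \<in> neighbours F i \<Longrightarrow> b \<in> neighbours F j \<Longrightarrow>
      R i a \<inter> R j b \<noteq> {} \<Longrightarrow> a = j \<or> b = i"
  shows "real (card F) \<le> t * real (card Y)"
  using assms(7-)
proof (induction "card Y" arbitrary: Y F rule: less_induct)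
  case less
  note F = less.prems(2)
  have finF: "finite F"
    by (rule finite_subset[of _ "Y \<times> Y"]) (use F less.prems(1) in auto)
  show ?case
  proof (cases "\<exists>i\<in>Y. \<exists>j. neighbours F i \<subseteq> {j}")
    case True
    then obtain i j where i: "i \<in> Y" and j: "neighbours F i \<subseteq> {j}" by blast
    let ?F = "{e \<in> F. fst e \<noteq> i \<and> snd e \<noteq> i}"
    have mono: "neighbours ?F k \<subseteq> neighbours F k" for k by (auto simp: neighbours_def)
    have "F - ?F \<subseteq> {(i, j), (j, i)}" using j by (auto simp: neighbours_def)
    \<comment> \<open>Pairs in \<open>F\<close> are increasing, so at most one of the two
      orientations occurs.\<close>
    then have "F - ?F \<subseteq> {(min i j, max i j)}" using F by fastforce
    then have "card (F - ?F) \<le> 1" using card_mono[of "{(min i j, max i j)}"] by simp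
    moreover have "card F = card ?F + card (F - ?F)"
      using finF by (subst card_Un_disjoint[symmetric]) (auto intro: arg_cong[where f = card])
    moreover have cY: "card Y = Suc (card (Y - {i}))" 
      using card_Suc_Diff1[OF less.prems(1) i] by simp
    moreover have "real (card ?F) \<le> t * real (card (Y - {i}))"
    proof (rule less.hyps)
      show "card (Y - {i}) < card Y" using cY by simp
      show "finite (Y - {i})" using less.prems(1) by simp
      show "k \<in> Y - {i} \<and> l \<in> Y - {i} \<and> k < l" if "(k, l) \<in> ?F" for k l
        using that F[of k l] by auto
      show "connected_in (parcs H) (R k l) \<and> h k \<in> R k l \<and> R k l \<subseteq> B k"
        if "l \<in> neighbours ?F k" for k l
        using that mono less.prems(3) by blast
      show "\<exists>x\<in>R k l \<inter> R l k. x = h k \<or>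
          (\<exists>z\<in>component (parcs H) (R k l - B l) (h k). (z, x) \<in> parcs H)"
        if "(k, l) \<in> ?F" for k l
        using less.prems(4)[of k l] that by simp
      show "a = l \<or> b = k"
        if "k \<noteq> l" "a \<in> neighbours ?F k" "b \<in> neighbours ?F l" "R k a \<inter> R l b \<noteq> {}" for k l a b
        using less.prems(5)[OF that(1) _ _ that(4)] that(2,3) mono by blast
    qed
    ultimately show ?thesis using t by (simp add: algebra_simps)
  next
    case False
    have Y: "i \<in> Y" if "j \<in> neighbours F i" for i j
      using that F by (auto simp: neighbours_def)
    interpret region_system "parcs H" Y "neighbours F" R B h
    proof
      show "sym (parcs H)" using H \<G>(1) by (auto simp: graph_class_def pair_graph_iff)
      show "neighbours F i \<subseteq> Y - {i}" if "i \<in> Y" for i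
        using F by (fastforce simp: neighbours_def)
      show "i \<in> neighbours F j" if "j \<in> neighbours F i" for i j
        using that by (auto simp: neighbours_def)
      show "\<exists>a\<in>neighbours F i. a \<noteq> j" if "i \<in> Y" for i j
        using False that by blast
      show "\<exists>x\<in>R i j \<inter> R j i. x = h i \<or>
          (\<exists>z\<in>component (parcs H) (R i j - B j) (h i). (z, x) \<in> parcs H)"
        if "i \<in> Y" "j \<in> neighbours F i" "i < j" for i j
      proof -
        have "(i, j) \<in> F" using that F[of j i] by (auto simp: neighbours_def)
        then show ?thesis by (rule less.prems(4))
      qed
      show "a = j \<or> b = i"
        if "i \<noteq> j" "a \<in> neighbours F i" "b \<in> neighbours F j" "R i a \<inter> R j b \<noteq> {}" for i j a b
        using less.prems(5) that by blast
    qed (use less.prems(3) in blast)+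
    show ?thesis
    proof (rule card_model_edges_le[OF \<G> H less.prems(1), of branch_set])
      show "branch_set i \<noteq> {} \<and> branch_set i \<subseteq> pverts H \<and> connected_in (parcs H) (branch_set i)"
        if "i \<in> Y" for i
        using that branch_set_subset B_sub connected_in_branch_set h_in_branch_set by blast
      show "disjoint_family_on branch_set Y"
        unfolding disjoint_family_on_def
        by (metis branch_set_disjoint inf_commute linorder_neqE_nat)
      show "i \<in> Y \<and> j \<in> Y \<and> i < j \<and> (\<exists>x\<in>branch_set i. \<exists>y\<in>branch_set j. (x, y) \<in> parcs H)"
        if "(i, j) \<in> F" for i j
        using F[OF that] that branch_set_adjacent by (simp add: neighbours_def)
    qed
  qed
qed

section \<open>Random sampling\<close>

text \<open>The sum is the probability that a random subset of \<open>V\<close>, with each element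
  chosen independently with probability \<open>p\<close>, contains \<open>I\<close> and avoids
  \<open>K\<close>. It is the expansion of the product of \<open>f i + g i\<close>, where
  \<open>f\<close> weighs membership and \<open>g\<close> non-membership; the factor is
  \<open>p\<close> on \<open>I\<close>, \<open>1 - p\<close> on \<open>K\<close> and 1
  elsewhere.\<close>

lemma sum_Pow_weights:
  fixes p :: real
  assumes "finite V" "I \<subseteq> V" "K \<subseteq> V" "I \<inter> K = {}"
  shows "(\<Sum>X\<in>Pow V. if I \<subseteq> X \<and> K \<inter> X = {} then p ^ card X * (1 - p) ^ card (V - X) else 0)
    = p ^ card I * (1 - p) ^ card K"
proof -
  define f where "f i = (if i \<in> K then 0 else p)" for i
  define g where "g i = (if i \<in> I then 0 else 1 - p)" for i
  have fin: "finite I" "finite K" using assms finite_subset by blast+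
  have "(if I \<subseteq> X \<and> K \<inter> X = {} then p ^ card X * (1 - p) ^ card (V - X) else 0)
      = prod f X * prod g (V - X)" if X: "X \<subseteq> V" for X
  proof (cases "I \<subseteq> X \<and> K \<inter> X = {}")
    case True
    then have "prod f X = (\<Prod>i\<in>X. p)" by (intro prod.cong) (auto simp: f_def)
    moreover have "prod g (V - X) = (\<Prod>i\<in>V - X. 1 - p)"
      using True by (intro prod.cong) (auto simp: g_def)
    ultimately show ?thesis using True by simp
  next
    case False
    have finX: "finite X" "finite (V - X)" using X assms(1) finite_subset by auto
    from False consider i where "i \<in> I" "i \<notin> X" | i where "i \<in> K" "i \<in> X" by blast
    then have "prod f X = 0 \<or> prod g (V - X) = 0"
    proof cases
      case (1 i)
      then have "prod g (V - X) = 0"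
        using finX assms(2) by (intro prod_zero) (auto simp: g_def)
      then show ?thesis ..
    next
      case (2 i)
      then have "prod f X = 0" using finX by (intro prod_zero) (auto simp: f_def)
      then show ?thesis ..
    qed
    then show ?thesis using False by auto
  qed
  then have "(\<Sum>X\<in>Pow V. if I \<subseteq> X \<and> K \<inter> X = {} then p ^ card X * (1 - p) ^ card (V - X) else 0)
      = (\<Sum>X\<in>Pow V. prod f X * prod g (V - X))"
    by (intro sum.cong) auto
  also have "\<dots> = (\<Prod>i\<in>V. f i + g i)" using prod_add[OF assms(1), of f g] by simp
  also have "\<dots> = (\<Prod>i\<in>I \<union> K. f i + g i)"
    using assms by (intro prod.mono_neutral_right) (auto simp: f_def g_def)
  also have "\<dots> = (\<Prod>i\<in>I. f i + g i) * (\<Prod>i\<in>K. f i + g i)"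
    using fin assms(4) by (rule prod.union_disjoint)
  also have "(\<Prod>i\<in>I. f i + g i) = (\<Prod>i\<in>I. p)"
    using assms(4) by (intro prod.cong) (auto simp: f_def g_def)
  also have "(\<Prod>i\<in>K. f i + g i) = (\<Prod>i\<in>K. 1 - p)"
    using assms(4) by (intro prod.cong) (auto simp: f_def g_def)
  finally show ?thesis by simp
qed

text \<open>A pair survives in the random set \<open>X\<close> with probability at least
  \<open>p^2 * (1 - p)^m\<close>, while the expected size of \<open>X\<close> is
  \<open>p * card V\<close>. Taking expectations in \<open>sparse\<close> bounds
  \<open>card D\<close>, and \<open>p = 1 / (m + 1)\<close> turns the factor
  \<open>1 / (p * (1 - p)^m)\<close> into at most \<open>e * (m + 1)\<close>.\<close>

lemma card_edges_le_by_sampling: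
  fixes D :: "('a \<times> 'a) set" and t :: real
  assumes V: "finite V" and t: "t \<ge> 0"
    and D: "\<And>i j. (i, j) \<in> D \<Longrightarrow> i \<in> V \<and> j \<in> V \<and> i \<noteq> j"
    and bad: "\<And>i j. (i, j) \<in> D \<Longrightarrow> bad i j \<subseteq> V - {i, j} \<and> card (bad i j) \<le> m"
    and sparse: "\<And>X. X \<subseteq> V \<Longrightarrow>
      real (card {(i, j) \<in> D. {i, j} \<subseteq> X \<and> bad i j \<inter> X = {}}) \<le> t * real (card X)"
  shows "real (card D) \<le> exp 1 * t * (real m + 1) * real (card V)"
proof -
  define p where "p = 1 / (real m + 1)"
  have p: "0 < p" "p \<le> 1" by (simp_all add: p_def)
  define w where "w X = p ^ card X * (1 - p) ^ card (V - X)" for X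
  have w: "w X \<ge> 0" for X using p by (simp add: w_def)
  have finD: "finite D" by (rule finite_subset[of _ "V \<times> V"]) (use D V in auto)
  have "real (card D) * (p\<^sup>2 * (1 - p) ^ m)
      \<le> (\<Sum>(i, j)\<in>D. p\<^sup>2 * (1 - p) ^ card (bad i j))"
    using p bad by (auto intro!: sum_bounded_below mult_left_mono power_decreasing)
  also have "\<dots> = (\<Sum>(i, j)\<in>D. \<Sum>X\<in>Pow V. if {i, j} \<subseteq> X \<and> bad i j \<inter> X = {} then w X else 0)"
  proof (intro sum.cong refl, clarify)
    fix i j assume ij: "(i, j) \<in> D"
    have "{i, j} \<subseteq> V" "bad i j \<subseteq> V" "{i, j} \<inter> bad i j = {}" "card {i, j} = 2"
      using D[OF ij] bad[OF ij] by auto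
    then show "p\<^sup>2 * (1 - p) ^ card (bad i j) =
        (\<Sum>X\<in>Pow V. if {i, j} \<subseteq> X \<and> bad i j \<inter> X = {} then w X else 0)"
      using sum_Pow_weights[OF V, of "{i, j}" "bad i j" p] unfolding w_def by simp
  qed
  also have "\<dots> = (\<Sum>X\<in>Pow V. \<Sum>(i, j)\<in>D. if {i, j} \<subseteq> X \<and> bad i j \<inter> X = {} then w X else 0)"
    unfolding case_prod_unfold by (rule sum.swap)
  also have "\<dots> = (\<Sum>X\<in>Pow V. w X * real (card {(i, j) \<in> D. {i, j} \<subseteq> X \<and> bad i j \<inter> X = {}}))"
    using finD by (intro sum.cong refl)
      (simp add: case_prod_unfold sum.If_cases Int_def mult.commute)
  also have "\<dots> \<le> (\<Sum>X\<in>Pow V. w X * (t * real (card X)))"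
    using sparse w by (intro sum_mono mult_left_mono) auto
  also have "\<dots> = t * (\<Sum>X\<in>Pow V. \<Sum>v\<in>V. if v \<in> X then w X else 0)"
    unfolding sum_distrib_left
  proof (intro sum.cong refl)
    fix X assume "X \<in> Pow V"
    then have "V \<inter> X = X" by blast
    then show "w X * (t * real (card X)) = (\<Sum>v\<in>V. t * (if v \<in> X then w X else 0))"
      using V by (simp add: sum.If_cases sum_distrib_left[symmetric])
  qed
  also have "(\<Sum>X\<in>Pow V. \<Sum>v\<in>V. if v \<in> X then w X else 0)
      = (\<Sum>v\<in>V. \<Sum>X\<in>Pow V. if v \<in> X then w X else 0)"
    by (rule sum.swap)
  also have "\<dots> = (\<Sum>v\<in>V. p)"
    using sum_Pow_weights[OF V, of "{_}" "{}" p] unfolding w_def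
    by (intro sum.cong refl) simp
  finally have *: "p * (real (card D) * (p * (1 - p) ^ m)) \<le> p * (t * real (card V))"
    by (simp add: power2_eq_square mult_ac)
  then have "real (card D) * (p * (1 - p) ^ m) \<le> t * real (card V)"
    using p(1) mult_le_cancel_left_pos by blast
  \<comment> \<open>For positive \<open>m\<close>, \<open>1 - p\<close> is the inverse of
    \<open>1 + 1/m\<close>, and \<open>(1 + 1/m)^m\<close> is at most \<open>e\<close>. The case
    \<open>m = 0\<close> is split off because of the division by \<open>m\<close>.\<close>
  moreover have q: "1 \<le> exp 1 * (1 - p) ^ m"
  proof (cases "m = 0")
    case False
    have "(1 + 1 / real m) ^ m \<le> exp (1 / real m) ^ m"
      using exp_ge_add_one_self[of "1 / real m"] by (intro power_mono) auto
    also have "\<dots> = exp 1" using False by (simp add: exp_of_nat_mult[symmetric])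
    finally have "(1 + 1 / real m) ^ m * (1 - p) ^ m \<le> exp 1 * (1 - p) ^ m"
      using p by (intro mult_right_mono) auto
    moreover have "1 + 1 / real m = (real m + 1) / real m" "1 - p = real m / (real m + 1)"
      using False by (simp_all add: p_def field_simps)
    then have "(1 + 1 / real m) * (1 - p) = 1"
      using False by (simp add: add_nonneg_eq_0_iff)
    ultimately show ?thesis by (simp add: power_mult_distrib[symmetric])
  qed simp
  moreover have "real (card D) * p * 1 \<le> real (card D) * p * (exp 1 * (1 - p) ^ m)"
    using q p by (intro mult_left_mono) auto
  ultimately have "real (card D) * p \<le> exp 1 * (t * real (card V))"
    by (smt (verit) exp_ge_zero mult.assoc mult.commute mult_left_mono)
  then show ?thesis by (simp add: p_def field_simps)
qed

section \<open>Centres of shallow branch sets\<close>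

text \<open>The library notion of connectedness refers to the symmetric closure, which has the same
  arc ends when these are already symmetric.\<close>

lemma connected_imp_connected_in:
  assumes "Digraph_Component.connected G" "sym (arcs_ends G)" "wf_digraph G"
  shows "connected_in (arcs_ends G) (verts G)"
  unfolding connected_in_def
proof (intro ballI)
  fix x y assume "x \<in> verts G" "y \<in> verts G"
  then have "(x, y) \<in> rtrancl_on (verts G) (arcs_ends (with_proj (mk_symmetric G)))"
    using assms(1) by (auto simp: connected_def strongly_connected_def reachable_def mk_symmetric_def)
  moreover have "arcs_ends (with_proj (mk_symmetric G)) = arcs_ends G"
    using assms(2) by (auto simp: mk_symmetric_def arcs_ends_def arc_to_ends_def dest: symD)
  ultimately have "(x, y) \<in> rtrancl_on (verts G) (arcs_ends G)" by simp
  then show "(x, y) \<in> (Restr (arcs_ends G) (verts G))\<^sup>*"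
    by (induction rule: converse_rtrancl_on_induct)
      (auto intro: converse_rtrancl_into_rtrancl)
qed

lemma connected_in_awalk_verts:
  assumes "sym E" "arcs_ends K \<subseteq> E" "pre_digraph.awalk K u p v"
  shows "connected_in E (set (pre_digraph.awalk_verts K u p))"
proof (rule connected_in_star[OF assms(1), where h = u])
  interpret pre_digraph K .
  have "\<forall>y\<in>set (awalk_verts u p). (u, y) \<in> (Restr E (set (awalk_verts u p)))\<^sup>*"
    if "cas u p v" "set p \<subseteq> arcs K" for u
    using that
  proof (induction p arbitrary: u)
    case (Cons e p)
    have "(tail K e, head K e) \<in> E"
      using Cons.prems(2) assms(2) by (auto simp: arcs_ends_def arc_to_ends_def)
    moreover have h: "head K e \<in> set (awalk_verts (head K e) p)" by (cases p) (use Cons.prems in auto)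
    ultimately have "(tail K e, head K e) \<in> (Restr E (set (awalk_verts u (e # p))))\<^sup>*" by auto
    moreover have "(head K e, y) \<in> (Restr E (set (awalk_verts u (e # p))))\<^sup>*"
      if "y \<in> set (awalk_verts (head K e) p)" for y
    proof (rule rtrancl_Restr_mono)
      show "(head K e, y) \<in> (Restr E (set (awalk_verts (head K e) p)))\<^sup>*"
        using Cons.IH[of "head K e"] Cons.prems that by auto
    qed auto
    ultimately show ?case using Cons.prems(1) by (auto intro: rtrancl_trans)
  qed simp
  then show "(u, y) \<in> (Restr E (set (awalk_verts u p)))\<^sup>*" if "y \<in> set (awalk_verts u p)" for y
    using assms(3) that by (auto simp: awalk_def)
qed

text \<open>The distance is an infimum over walks of integer cost. If every walk were longer than
  \<open>r\<close>, all costs and hence the infimum would be at least \<open>r + 1\<close>; this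
  covers the case of no walk at all, with infinite distance.\<close>

lemma dist_in_le_imp_awalk:
  assumes "wf_digraph K" "dist_in K c w \<le> ereal (real r)"
  shows "\<exists>p. pre_digraph.awalk K c p w \<and> length p \<le> r"
proof (rule ccontr)
  interpret wf_digraph K by fact
  assume "\<not> ?thesis"
  then have "ereal (real r + 1) \<le> ereal (awalk_cost (\<lambda>_. 1) p)" if "awalk c p w" for p
    using that by (force simp: awalk_cost_def sum_list_triv not_le)
  then have "ereal (real r + 1) \<le> dist_in K c w"
    unfolding dist_in_def \<mu>_def by (intro INF_greatest) auto
  also note assms(2)
  finally show False by simp
qed

text \<open>\<open>radius\<close> is a \<open>LEAST\<close>, so some admissible value must be shown
  to exist: from any vertex \<open>c\<close>, take the longest of finitely many chosen
  walks.\<close>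

lemma radius_attained:
  assumes "wf_digraph K" "Digraph_Component.connected K" "sym (arcs_ends K)" "finite (verts K)"
  shows "\<exists>c\<in>verts K. \<forall>w\<in>verts K. dist_in K c w \<le> ereal (real (radius K))"
  unfolding radius_def
proof (rule LeastI_ex)
  interpret wf_digraph K by fact
  obtain c where c: "c \<in> verts K"
    using assms(2) by (auto simp: connected_def strongly_connected_def mk_symmetric_def)
  have "\<exists>p. awalk c p w" if "w \<in> verts K" for w
  proof -
    have "(c, w) \<in> (Restr (arcs_ends K) (verts K))\<^sup>*"
      using connected_imp_connected_in[OF assms(2,3,1)] c that by (auto simp: connected_in_def)
    then have "(c, w) \<in> rtrancl_on (verts K) (arcs_ends K)"
      by (induction rule: rtrancl_induct) (use c in \<open>auto intro: rtrancl_on_into_rtrancl_on\<close>)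
    then show ?thesis by (simp add: reachable_awalk[symmetric] reachable_def)
  qed
  then obtain p where p: "\<And>w. w \<in> verts K \<Longrightarrow> awalk c (p w) w" by metis
  define r where "r = Max ((\<lambda>w. length (p w)) ` verts K)"
  have "dist_in K c w \<le> ereal (real r)" if w: "w \<in> verts K" for w
  proof -
    have "dist_in K c w \<le> awalk_cost (\<lambda>_. 1) (p w)"
      unfolding dist_in_def by (rule min_cost_le_walk_cost[OF p[OF w]])
    also have "awalk_cost (\<lambda>_. 1) (p w) = real (length (p w))"
      by (simp add: awalk_cost_def sum_list_triv)
    also have "length (p w) \<le> r"
      unfolding r_def using assms(4) w by (intro Max_ge) auto
    finally show ?thesis by simp
  qed
  then show "\<exists>r. \<exists>c\<in>verts K. \<forall>w\<in>verts K. dist_in K c w \<le> ereal (real r)" using c by blast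
qed

text \<open>\<open>P\<close> is the vertex set of a walk of length at most \<open>r\<close> from a
  centre, hence the bound \<open>r + 1\<close>.\<close>

lemma shallow_center:
  assumes G: "pair_graph G" and S: "S \<subseteq> pverts G"
    and con: "Digraph_Component.connected (with_proj G \<restriction> S)"
    and rad: "radius (with_proj G \<restriction> S) \<le> r"
  shows "\<exists>c\<in>S. \<forall>w\<in>S. \<exists>P. {c, w} \<subseteq> P \<and> P \<subseteq> S \<and> connected_in (parcs G) P \<and> card P \<le> r + 1"
proof -
  interpret pair_graph G by fact
  let ?K = "with_proj G \<restriction> S"
  have sym: "sym (parcs G)" using G by (simp add: pair_graph_iff)
  have fin: "finite S" using S pair_finite_verts by (rule finite_subset)
  have ends: "arcs_ends ?K = Restr (parcs G) S"
    by (auto simp: arcs_ends_def arc_to_ends_def image_iff)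
  interpret K: wf_digraph ?K using S by (intro wellformed_induce_subgraph) 
  have "sym (arcs_ends ?K)" unfolding ends using sym by (auto simp: sym_def)
  then obtain c where c: "c \<in> S" "\<And>w. w \<in> S \<Longrightarrow> dist_in ?K c w \<le> ereal (real (radius ?K))"
    using radius_attained[OF K.wf_digraph_axioms con] fin by auto
  have "\<exists>P. {c, w} \<subseteq> P \<and> P \<subseteq> S \<and> connected_in (parcs G) P \<and> card P \<le> r + 1" if w: "w \<in> S" for w
  proof -
    obtain p where p: "K.awalk c p w" "length p \<le> radius ?K"
      using dist_in_le_imp_awalk[OF K.wf_digraph_axioms c(2)[OF w]] by blast
    let ?P = "set (K.awalk_verts c p)"
    have "K.awhd c p = c" "K.awlast c p = w" using p(1) unfolding K.awalk_conv by blast+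
    then have "c \<in> ?P" "w \<in> ?P"
      using hd_in_set[OF K.awalk_verts_non_Nil, of c p] last_in_set[OF K.awalk_verts_non_Nil, of c p]
      by simp_all
    moreover have "?P \<subseteq> S" using p(1) K.awalk_verts_in_verts[of c p] by (auto simp: K.awalk_def)
    moreover have "connected_in (parcs G) ?P"
      by (rule connected_in_awalk_verts[OF sym _ p(1)]) (use ends in blast)
    moreover have "card ?P \<le> r + 1"
      using card_length[of "K.awalk_verts c p"] p(2) rad by (simp add: K.length_awalk_verts)
    ultimately show ?thesis by blast
  qed
  then show ?thesis using c(1) by blast
qed

section \<open>Orientations of bounded out-degree\<close>

text \<open>Hall's theorem with capacities, by the Halmos--Vaughan induction.\<close>

lemma capacity_choice:
  fixes \<E> :: "'a set set" and c :: "'a \<Rightarrow> nat"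
  assumes "finite \<E>" "\<And>e. e \<in> \<E> \<Longrightarrow> finite e"
    and "\<And>\<F>. \<F> \<subseteq> \<E> \<Longrightarrow> card \<F> \<le> (\<Sum>v\<in>\<Union>\<F>. c v)"
  shows "\<exists>f. (\<forall>e\<in>\<E>. f e \<in> e) \<and> (\<forall>v. card {e \<in> \<E>. f e = v} \<le> c v)"
  using assms
proof (induction "card \<E>" arbitrary: \<E> c rule: less_induct)
  case less
  note fin = less.prems(1,2) and hall = less.prems(3)
  have fin_Union: "finite (\<Union>\<F>)" if "\<F> \<subseteq> \<E>" for \<F>
    using that fin finite_subset by blast
  consider "\<E> = {}"
    | (tight) \<F> where "\<F> \<subset> \<E>" "\<F> \<noteq> {}" "card \<F> = (\<Sum>v\<in>\<Union>\<F>. c v)"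
    | (strict) "\<E> \<noteq> {}" "\<And>\<F>. \<F> \<subset> \<E> \<Longrightarrow> \<F> \<noteq> {} \<Longrightarrow> card \<F> < (\<Sum>v\<in>\<Union>\<F>. c v)"
    using hall by (meson le_neq_implies_less psubset_imp_subset)
  then show ?case
  proof cases
    case tight
    have fin\<F>: "finite \<F>" using tight(1) fin(1) finite_subset by blast
    \<comment> \<open>A tight family may use up all capacity on its union, so the other edges get
      none there. Their Hall condition follows by adding \<open>\<F>\<close> to a subfamily and
      cancelling the tight equation.\<close>
    define c' where "c' v = (if v \<in> \<Union>\<F> then 0 else c v)" for v
    have lt: "card \<F> < card \<E>" using tight(1) fin(1) by (simp add: psubset_card_mono)
    have "\<exists>f. (\<forall>e\<in>\<F>. f e \<in> e) \<and> (\<forall>v. card {e \<in> \<F>. f e = v} \<le> c v)"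
      by (rule less.hyps[OF lt fin\<F>]) (use tight(1) fin(2) hall in auto)
    then obtain f where f: "\<And>e. e \<in> \<F> \<Longrightarrow> f e \<in> e" "\<And>v. card {e \<in> \<F>. f e = v} \<le> c v"
      by blast
    have "\<exists>f. (\<forall>e\<in>\<E> - \<F>. f e \<in> e) \<and> (\<forall>v. card {e \<in> \<E> - \<F>. f e = v} \<le> c' v)"
    proof (rule less.hyps)
      show "card (\<E> - \<F>) < card \<E>"
        using tight(1,2) fin(1) by (intro psubset_card_mono) auto
      fix \<H> assume \<H>: "\<H> \<subseteq> \<E> - \<F>"
      then have fin\<H>: "finite \<H>" using fin(1) finite_subset by blast
      have "card \<H> + card \<F> = card (\<H> \<union> \<F>)"
        using \<H> fin\<F> fin\<H> by (intro card_Un_disjoint[symmetric]) auto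
      also have "\<dots> \<le> (\<Sum>v\<in>\<Union>(\<H> \<union> \<F>). c v)"
        using \<H> tight(1) by (intro hall) auto
      also have "\<Union>(\<H> \<union> \<F>) = (\<Union>\<H> - \<Union>\<F>) \<union> \<Union>\<F>" by blast
      also have "(\<Sum>v\<in>\<dots>. c v) = (\<Sum>v\<in>\<Union>\<H> - \<Union>\<F>. c v) + (\<Sum>v\<in>\<Union>\<F>. c v)"
        using \<H> tight(1) by (intro sum.union_disjoint finite_Diff fin_Union) auto
      also have "(\<Sum>v\<in>\<Union>\<H> - \<Union>\<F>. c v) = (\<Sum>v\<in>\<Union>\<H>. c' v)"
        using \<H> by (intro sum.mono_neutral_cong_left fin_Union) (auto simp: c'_def)
      finally show "card \<H> \<le> (\<Sum>v\<in>\<Union>\<H>. c' v)" using tight(3) by simp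
    qed (use fin in auto)
    then obtain g where g: "\<And>e. e \<in> \<E> - \<F> \<Longrightarrow> g e \<in> e"
      "\<And>v. card {e \<in> \<E> - \<F>. g e = v} \<le> c' v" by blast
    define k where "k e = (if e \<in> \<F> then f e else g e)" for e
    have "card {e \<in> \<E>. k e = v} \<le> c v" for v
    proof -
      have eq: "{e \<in> \<E>. k e = v} = {e \<in> \<F>. f e = v} \<union> {e \<in> \<E> - \<F>. g e = v}"
        using tight(1) by (auto simp: k_def)
      have "card {e \<in> \<E>. k e = v} \<le> card {e \<in> \<F>. f e = v} + card {e \<in> \<E> - \<F>. g e = v}"
        unfolding eq by (rule card_Un_le)
      also have "\<dots> \<le> c v"
      proof (cases "v \<in> \<Union>\<F>")
        case True
        then show ?thesis using f(2)[of v] g(2)[of v] by (simp add: c'_def)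
      next
        case False
        then have empty: "{e \<in> \<F>. f e = v} = {}" using f(1) by blast
        show ?thesis using False g(2)[of v] unfolding empty by (simp add: c'_def)
      qed
      finally show ?thesis .
    qed
    moreover have "\<forall>e\<in>\<E>. k e \<in> e" using f(1) g(1) by (auto simp: k_def)
    ultimately show ?thesis by blast
  next
    case strict
    then obtain e where e: "e \<in> \<E>" by blast
    have "1 \<le> (\<Sum>v\<in>e. c v)" using hall[of "{e}"] e by simp
    then obtain v where v: "v \<in> e" "c v \<ge> 1"
      by (metis One_nat_def Suc_le_eq not_gr_zero sum.neutral)
    \<comment> \<open>Subfamilies avoiding \<open>e\<close> are proper, so the nonempty ones have a
      spare unit that makes up for the one spent on \<open>e\<close>.\<close>
    define c' where "c' = c(v := c v - 1)"
    have "\<exists>f. (\<forall>a\<in>\<E> - {e}. f a \<in> a) \<and> (\<forall>u. card {a \<in> \<E> - {e}. f a = u} \<le> c' u)"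
    proof (rule less.hyps)
      show "card (\<E> - {e}) < card \<E>" using fin(1) e by (rule card_Diff1_less)
      fix \<F> assume \<F>: "\<F> \<subseteq> \<E> - {e}"
      show "card \<F> \<le> (\<Sum>v\<in>\<Union>\<F>. c' v)"
      proof (cases "\<F> = {}")
        case False
        have finU: "finite (\<Union>\<F>)" using \<F> by (intro fin_Union) auto
        have "card \<F> < (\<Sum>u\<in>\<Union>\<F>. c u)" using \<F> e False by (intro strict(2)) auto
        also have "\<dots> \<le> (\<Sum>u\<in>\<Union>\<F>. c' u + (if u = v then 1 else 0))"
          using v(2) by (intro sum_mono) (simp add: c'_def)
        also have "\<dots> \<le> (\<Sum>u\<in>\<Union>\<F>. c' u) + 1"
          using finU by (simp add: sum.distrib)
        finally show ?thesis by simp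
      qed simp
    qed (use fin in auto)
    then obtain f where f: "\<And>a. a \<in> \<E> - {e} \<Longrightarrow> f a \<in> a"
      "\<And>u. card {a \<in> \<E> - {e}. f a = u} \<le> c' u" by blast
    have "card {a \<in> \<E>. (f(e := v)) a = u} \<le> c u" for u
    proof (cases "u = v")
      case True
      then have "{a \<in> \<E>. (f(e := v)) a = u} = insert e {a \<in> \<E> - {e}. f a = u}" using e by auto
      then have "card {a \<in> \<E>. (f(e := v)) a = u} = Suc (card {a \<in> \<E> - {e}. f a = u})"
        using fin(1) by simp
      then show ?thesis using f(2)[of u] v(2) True by (simp add: c'_def)
    next
      case False
      then have "{a \<in> \<E>. (f(e := v)) a = u} = {a \<in> \<E> - {e}. f a = u}" by auto
      then show ?thesis using f(2)[of u] False by (simp add: c'_def)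
    qed
    moreover have "\<forall>a\<in>\<E>. (f(e := v)) a \<in> a" using f(1) v(1) by auto
    ultimately show ?thesis by blast
  qed simp
qed

lemma edge_density_le_max_density:
  assumes "pair_graph G" "pair_graph K" "subgraph (with_proj K) (with_proj G)"
  shows "edge_density K \<le> max_density G"
proof -
  have "finite (pverts G)" using assms(1) by (simp add: pair_graph_iff)
  then have "finite {edge_density K | K. pair_graph K \<and> subgraph (with_proj K) (with_proj G)}"
    by (intro finite_edge_densities[where n = "card (pverts G)"])
      (auto simp: subgraph_def intro: card_mono)
  then show ?thesis unfolding max_density_def by (rule Max_ge) (use assms in blast)
qed

text \<open>Hall's theorem assigns each edge to one of its ends, its tail, with capacity
  \<open>d\<close> at every vertex. The Hall condition for a set of edges is the density bound for
  the subgraph they form.\<close>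

lemma bounded_out_degree_orientation:
  assumes G: "pair_graph G" and d: "max_density G \<le> real d"
  shows "\<exists>out. (\<forall>v. finite (out v) \<and> card (out v) \<le> d) \<and>
    (\<forall>u v. (u, v) \<in> parcs G \<longrightarrow> v \<in> out u \<or> u \<in> out v)"
proof -
  have fin: "finite (pverts G)" and sub: "parcs G \<subseteq> pverts G \<times> pverts G"
    and sym: "sym (parcs G)" and irr: "irrefl (parcs G)"
    using G by (simp_all add: pair_graph_iff)
  have edges_Pow: "edges G \<subseteq> Pow (pverts G)" using G by (rule edges_subset_Pow)
  then have fin_edges: "finite (edges G)" using fin by (meson finite_Pow_iff finite_subset)
  have "\<exists>f. (\<forall>e\<in>edges G. f e \<in> e) \<and> (\<forall>v. card {e \<in> edges G. f e = v} \<le> d)"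
  proof (rule capacity_choice[OF fin_edges])
    show "finite e" if "e \<in> edges G" for e using that edges_Pow fin finite_subset by blast
    fix \<F> assume \<F>: "\<F> \<subseteq> edges G"
    \<comment> \<open>The vertices are exactly those covered by \<open>\<F>\<close>, so that the
      density of \<open>K\<close> compares \<open>card \<F>\<close> with
      \<open>card (\<Union>\<F>)\<close>.\<close>
    define K where "K = \<lparr> pverts = \<Union>\<F>, parcs = {(u, v) \<in> parcs G. {u, v} \<in> \<F>} \<rparr>"
    have finK: "finite (pverts K)"
      using \<F> edges_Pow fin by (auto simp: K_def intro: finite_subset)
    have K_sub: "parcs K \<subseteq> pverts K \<times> pverts K" by (auto simp: K_def)
    have "sym (parcs K)"
      by (rule symI) (auto simp: K_def insert_commute dest: symD[OF sym])
    moreover have "irrefl (parcs K)" using irr by (auto simp: K_def irrefl_def)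
    ultimately have K: "pair_graph K" using finK K_sub by (simp add: pair_graph_iff)
    have "subgraph (with_proj K) (with_proj G)"
      using edges_Pow \<F> sub K_sub
      by (auto simp: subgraph_def K_def wf_digraph_wp_iff pair_wf_digraph_def)
    then have dens: "edge_density K \<le> real d"
      using edge_density_le_max_density[OF G K] d by simp
    have "pverts K = \<Union>\<F>" by (simp add: K_def)
    have "edges K = \<F>" using \<F> by (fastforce simp: edges_def K_def)
    show "card \<F> \<le> (\<Sum>v\<in>\<Union>\<F>. d)"
    proof (cases "\<Union>\<F> = {}")
      case True
      then have "\<F> = {}" using \<F> by (fastforce simp: edges_def)
      then show ?thesis by simp
    next
      case False
      then have "card (\<Union>\<F>) > 0" using finK by (simp add: K_def card_gt_0_iff)
      moreover have "real (card \<F>) / real (card (\<Union>\<F>)) \<le> real d"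
        using dens False unfolding edge_density_def \<open>edges K = \<F>\<close> \<open>pverts K = \<Union>\<F>\<close>
        by (simp only: if_False)
      ultimately have "real (card \<F>) \<le> real (d * card (\<Union>\<F>))"
        by (simp add: pos_divide_le_eq)
      then have "card \<F> \<le> d * card (\<Union>\<F>)" by (simp only: of_nat_le_iff)
      then show ?thesis by (simp add: mult.commute)
    qed
  qed
  then obtain f where f: "\<And>e. e \<in> edges G \<Longrightarrow> f e \<in> e" "\<And>v. card {e \<in> edges G. f e = v} \<le> d"
    by blast
  define out where "out v = {w. {v, w} \<in> edges G \<and> f {v, w} = v}" for v
  have "finite (out v) \<and> card (out v) \<le> d" for v
  proof -
    have inj: "inj_on (\<lambda>w. {v, w}) (out v)" by (auto simp: inj_on_def doubleton_eq_iff)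
    have im: "(\<lambda>w. {v, w}) ` out v \<subseteq> {e \<in> edges G. f e = v}" by (auto simp: out_def)
    have "finite {e \<in> edges G. f e = v}" using fin_edges by simp
    then show ?thesis
      using card_inj_on_le[OF inj im] inj_on_finite[OF inj im] f(2)[of v] by linarith
  qed
  moreover have "v \<in> out u \<or> u \<in> out v" if "(u, v) \<in> parcs G" for u v
  proof -
    have "{u, v} \<in> edges G" using that by (auto simp: edges_def)
    then show ?thesis using f(1)[of "{u, v}"] by (auto simp: out_def insert_commute)
  qed
  ultimately show ?thesis by blast
qed

section \<open>Shallow minors of region intersection graphs\<close>

text \<open>Regions of adjacent vertices share a point, so a walk in \<open>P\<close> lifts to a
  walk through the union of the regions.\<close>

lemma connected_in_region:
  assumes G: "connected_in (parcs G) P" and E: "sym E"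
    and con: "\<And>v. v \<in> P \<Longrightarrow> connected_in E (C v)"
    and meet: "\<And>u v. u \<in> P \<Longrightarrow> v \<in> P \<Longrightarrow> (u, v) \<in> parcs G \<Longrightarrow> C u \<inter> C v \<noteq> {}"
  shows "connected_in E (\<Union>v\<in>P. C v)"
  unfolding connected_in_def
proof (intro ballI)
  let ?U = "\<Union>v\<in>P. C v"
  have within: "(x, y) \<in> (Restr E ?U)\<^sup>*" if "v \<in> P" "x \<in> C v" "y \<in> C v" for v x y
    by (rule rtrancl_Restr_mono[where A = "C v"])
      (use con[OF that(1)] that in \<open>auto simp: connected_in_def\<close>)
  fix x y assume "x \<in> ?U" "y \<in> ?U"
  then obtain u v where uv: "u \<in> P" "x \<in> C u" "v \<in> P" "y \<in> C v" by blast
  have "(u, v) \<in> (Restr (parcs G) P)\<^sup>*" using G uv by (auto simp: connected_in_def)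
  then have "\<forall>y\<in>C v. (x, y) \<in> (Restr E ?U)\<^sup>*"
  proof (induction rule: rtrancl_induct)
    case base
    then show ?case using within uv by blast
  next
    case (step v w)
    then have w: "v \<in> P" "w \<in> P" "(v, w) \<in> parcs G" by auto
    then obtain z where z: "z \<in> C v" "z \<in> C w" using meet by blast
    then have "(x, z) \<in> (Restr E ?U)\<^sup>*" using step.IH by blast
    then show ?case using within[OF w(2) z(2)] by (blast intro: rtrancl_trans)
  qed
  then show "(x, y) \<in> (Restr E ?U)\<^sup>*" using uv by blast
qed

text \<open>Only the vertex sets of the regions matter afterwards; their connectivity passes from
  the arcs of the subgraphs to those of \<open>H\<close>.\<close>

lemma region_intersection_graphE:
  assumes "region_intersection_graph G H"
  obtains C where "\<And>v. v \<in> pverts G \<Longrightarrow> C v \<subseteq> pverts H \<and> C v \<noteq> {} \<and> connected_in (parcs H) (C v)"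
    and "\<And>u v. u \<in> pverts G \<Longrightarrow> v \<in> pverts G \<Longrightarrow> u \<noteq> v \<Longrightarrow> (u, v) \<in> parcs G \<longleftrightarrow> C u \<inter> C v \<noteq> {}"
proof -
  obtain A where A: "\<And>v. v \<in> pverts G \<Longrightarrow> pair_graph (A v) \<and>
        subgraph (with_proj (A v)) (with_proj H) \<and> Digraph_Component.connected (with_proj (A v))"
    and adj: "\<And>u v. u \<in> pverts G \<Longrightarrow> v \<in> pverts G \<Longrightarrow> u \<noteq> v \<Longrightarrow>
        (u, v) \<in> parcs G \<longleftrightarrow> pverts (A u) \<inter> pverts (A v) \<noteq> {}"
    using assms unfolding region_intersection_graph_def by blast
  have "pverts (A v) \<subseteq> pverts H \<and> pverts (A v) \<noteq> {} \<and> connected_in (parcs H) (pverts (A v))"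
    if v: "v \<in> pverts G" for v
  proof -
    have sub: "pverts (A v) \<subseteq> pverts H" "parcs (A v) \<subseteq> parcs H" "wf_digraph (with_proj (A v))"
      and con: "Digraph_Component.connected (with_proj (A v))" and sym: "sym (parcs (A v))"
      using A[OF v] by (simp_all add: subgraph_def pair_graph_iff)
    have "connected_in (parcs (A v)) (pverts (A v))"
      using connected_imp_connected_in[OF con _ sub(3)] sym by simp
    moreover have "(Restr (parcs (A v)) (pverts (A v)))\<^sup>* \<subseteq> (Restr (parcs H) (pverts (A v)))\<^sup>*"
      using sub(2) by (intro rtrancl_mono) blast
    ultimately have "connected_in (parcs H) (pverts (A v))" unfolding connected_in_def by blast
    moreover have "pverts (A v) \<noteq> {}"
      using con by (auto simp: connected_def strongly_connected_def mk_symmetric_def)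
    ultimately show ?thesis using sub(1) by blast
  qed
  then show thesis using adj by (rule that)
qed

text \<open>Combines the orientation, the centres, the region lemma and the sampling: the regions of
  \<open>region_system\<close> are unions of the regions \<open>A v\<close> along spokes.\<close>

lemma card_edges_shallow_minor_le:
  fixes J :: "nat pair_pre_digraph" and \<G> :: "nat pair_pre_digraph set"
  assumes \<G>: "graph_class \<G>" "minor_closed \<G>" "\<forall>H\<in>\<G>. edge_density H \<le> t" and t: "t \<ge> 1"
    and G: "pair_graph G" and rig: "region_intersection_graph_over G \<G>"
    and d: "max_density G \<le> real d"
    and J: "pair_graph J" and minor: "shallow_minor r J G"
  shows "real (card (edges J)) \<le>
    exp 1 * t * (real ((2 * r + 2) * d) + 1) * real (card (pverts J))"
proof -
  obtain H where H: "H \<in> \<G>" and "region_intersection_graph G H"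
    using rig by (auto simp: region_intersection_graph_over_def)
  then obtain A where
    A: "\<And>v. v \<in> pverts G \<Longrightarrow> A v \<subseteq> pverts H \<and> A v \<noteq> {} \<and> connected_in (parcs H) (A v)"
    and A_meet: "\<And>u v. u \<in> pverts G \<Longrightarrow> v \<in> pverts G \<Longrightarrow> u \<noteq> v \<Longrightarrow>
      (u, v) \<in> parcs G \<longleftrightarrow> A u \<inter> A v \<noteq> {}"
    by (elim region_intersection_graphE) blast
  obtain out where out: "\<And>v. finite (out v)" "\<And>v. card (out v) \<le> d"
    and oriented: "\<And>u v. (u, v) \<in> parcs G \<Longrightarrow> v \<in> out u \<or> u \<in> out v"
    using bounded_out_degree_orientation[OF G d] by blast
  define V where "V = pverts J"
  define E where "E = parcs H"
  have symE: "sym E" using H \<G>(1) by (auto simp: E_def graph_class_def pair_graph_iff)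
  have V: "finite V" and irrJ: "irrefl (parcs J)" and symJ: "sym (parcs J)"
    and J_sub: "parcs J \<subseteq> V \<times> V" using J by (simp_all add: pair_graph_iff V_def)
  have irrG: "irrefl (parcs G)" and finG: "finite (pverts G)" using G by (simp_all add: pair_graph_iff)
  obtain S where "shallow_model r S J G" using minor by (auto simp: shallow_minor_def)
  then have S_sub: "\<And>i. i \<in> V \<Longrightarrow> S i \<subseteq> pverts G"
    and S_disj: "\<And>i j. i \<in> V \<Longrightarrow> j \<in> V \<Longrightarrow> i \<noteq> j \<Longrightarrow> S i \<inter> S j = {}"
    and S_con: "\<And>i. i \<in> V \<Longrightarrow> Digraph_Component.connected (with_proj G \<restriction> S i)"
    and S_rad: "\<And>i. i \<in> V \<Longrightarrow> radius (with_proj G \<restriction> S i) \<le> r"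
    and S_adj: "\<And>i j. (i, j) \<in> parcs J \<Longrightarrow> \<exists>x\<in>S i. \<exists>y\<in>S j. (x, y) \<in> parcs G"
    by (auto simp: shallow_model_def is_model_def V_def disjoint_family_on_def)
  \<comment> \<open>A spoke links the centre \<open>c\<close> to the place where an edge of
    \<open>J\<close> is realised.\<close>
  define spoke where "spoke i c P \<longleftrightarrow>
    c \<in> P \<and> P \<subseteq> S i \<and> connected_in (parcs G) P \<and> card P \<le> r + 1" for i c P
  have "\<exists>c. c \<in> S i \<and> (\<forall>w\<in>S i. \<exists>P. spoke i c P \<and> w \<in> P)" if iV: "i \<in> V" for i
  proof -
    obtain c where "c \<in> S i" and P: "\<forall>w\<in>S i. \<exists>P. {c, w} \<subseteq> P \<and> P \<subseteq> S i \<and>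
        connected_in (parcs G) P \<and> card P \<le> r + 1"
      using shallow_center[OF G S_sub[OF iV] S_con[OF iV] S_rad[OF iV]] by blast
    moreover have "\<exists>P. spoke i c P \<and> w \<in> P" if "w \<in> S i" for w
      using P that unfolding spoke_def by (meson insert_subset)
    ultimately show ?thesis by blast
  qed
  then obtain c where c: "\<And>i. i \<in> V \<Longrightarrow> c i \<in> S i"
    and spoke: "\<And>i w. i \<in> V \<Longrightarrow> w \<in> S i \<Longrightarrow> \<exists>P. spoke i (c i) P \<and> w \<in> P"
    by metis
  \<comment> \<open>The root \<open>h i\<close> is any point of the region of the centre, and so
    lies in the region of every spoke of \<open>i\<close>.\<close>
  have "\<exists>x. x \<in> A (c i)" if "i \<in> V" for i using A c S_sub that by blast
  then obtain h where h: "\<And>i. i \<in> V \<Longrightarrow> h i \<in> A (c i)" by metis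
  define region where "region P = (\<Union>v\<in>P. A v)" for P
  \<comment> \<open>The default \<open>{}\<close> makes \<open>B i \<subseteq> pverts H\<close> hold
    for every index, as \<open>card_region_edges_le\<close> requires.\<close>
  define B where "B i = (if i \<in> V then region (S i) else {})" for i
  have region_connected: "connected_in E (region P)" if "i \<in> V" "spoke i (c i) P" for i P
    unfolding region_def
  proof (rule connected_in_region[where G = G])
    have "P \<subseteq> pverts G" using that S_sub by (auto simp: spoke_def)
    then show "connected_in E (A v)" if "v \<in> P" for v using A that by (auto simp: E_def)
    show "A u \<inter> A v \<noteq> {}" if "u \<in> P" "v \<in> P" "(u, v) \<in> parcs G" for u v
      using A_meet[of u v] irrG that \<open>P \<subseteq> pverts G\<close> by (auto simp: irrefl_def)
  qed (use that symE in \<open>auto simp: spoke_def\<close>)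
  have h_region: "h i \<in> region P" if "i \<in> V" "spoke i (c i) P" for i P
    using that h by (auto simp: region_def spoke_def)

  define D where "D = {(i, j) \<in> parcs J. i < j}"
  have D: "i \<in> V \<and> j \<in> V \<and> i < j" if "(i, j) \<in> D" for i j using that J_sub by (auto simp: D_def)

  \<comment> \<open>first hit: leaving \<open>h i\<close> inside \<open>region P\<close>, the first point \<open>x\<close> of \<open>B j\<close> determines \<open>Q\<close>\<close>
  have "\<exists>P Q. spoke i (c i) P \<and> spoke j (c j) Q \<and> (\<exists>x\<in>region P \<inter> region Q. x = h i \<or>
      (\<exists>z\<in>component E (region P - B j) (h i). (z, x) \<in> E))" if ij: "(i, j) \<in> D" for i j
  proof -
    have V: "i \<in> V" "j \<in> V" "i \<noteq> j" using D[OF ij] by auto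
    have Q: "\<exists>Q. spoke j (c j) Q \<and> x \<in> region Q" if x: "x \<in> B j" for x
    proof -
      obtain w where "w \<in> S j" "x \<in> A w" using x V(2) by (auto simp: B_def region_def)
      then show ?thesis using spoke[OF V(2)] by (fastforce simp: region_def)
    qed
    obtain u v where uv: "u \<in> S i" "v \<in> S j" "(u, v) \<in> parcs G"
      using S_adj[of i j] ij by (auto simp: D_def)
    then have "A u \<inter> A v \<noteq> {}"
      using A_meet[of u v] S_sub S_disj V by (metis disjoint_iff subsetD)
    then obtain y where y: "y \<in> A u" "y \<in> A v" by blast
    obtain P where P: "spoke i (c i) P" "u \<in> P" using spoke[OF V(1) uv(1)] by blast
    show ?thesis
    proof (cases "h i \<in> B j")
      case True
      then show ?thesis using Q h_region[OF V(1) P(1)] P(1) by blast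
    next
      case False
      have "y \<in> region P" using y P by (auto simp: region_def)
      then have "(h i, y) \<in> (Restr E (region P))\<^sup>*"
        using region_connected[OF V(1) P(1)] h_region[OF V(1) P(1)] by (auto simp: connected_in_def)
      moreover have "y \<in> B j" using y uv V by (auto simp: B_def region_def)
      ultimately obtain z x where zx: "z \<in> component E (region P - B j) (h i)"
        "x \<in> region P" "x \<in> B j" "(z, x) \<in> E"
        using component_exit[OF _ False, of y E "region P"] by blast
      obtain Q where "spoke j (c j) Q" "x \<in> region Q" using Q[OF zx(3)] by blast
      then show ?thesis using P(1) zx by blast
    qed
  qed
  then obtain P Q where PQ: "\<And>i j. (i, j) \<in> D \<Longrightarrow> spoke i (c i) (P i j) \<and> spoke j (c j) (Q i j)"
    and contact: "\<And>i j. (i, j) \<in> D \<Longrightarrow> \<exists>x\<in>region (P i j) \<inter> region (Q i j). x = h i \<or>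
      (\<exists>z\<in>component E (region (P i j) - B j) (h i). (z, x) \<in> E)"
    by metis
  \<comment> \<open>The spoke of \<open>i\<close> towards \<open>j\<close>, whichever of the two is
    smaller.\<close>
  define T where "T i j = (if i < j then P i j else Q j i)" for i j
  have T: "spoke i (c i) (T i j)" "i \<in> V" if "(i, j) \<in> D \<or> (j, i) \<in> D" for i j
    using that PQ D by (auto simp: T_def dest: D)

  define bad where "bad i j = {l \<in> V - {i, j}. \<exists>v\<in>P i j \<union> Q i j. out v \<inter> S l \<noteq> {}}" for i j
  have card_bad: "card (bad i j) \<le> (2 * r + 2) * d" if ij: "(i, j) \<in> D" for i j
  proof -
    let ?M = "\<Union>v\<in>P i j \<union> Q i j. out v"
    have fin: "finite (P i j)" "finite (Q i j)"
      using PQ[OF ij] D[OF ij] S_sub finG by (meson spoke_def finite_subset)+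
    have "\<exists>x. x \<in> ?M \<inter> S l" if "l \<in> bad i j" for l using that by (auto simp: bad_def)
    then obtain g where g: "\<And>l. l \<in> bad i j \<Longrightarrow> g l \<in> ?M \<inter> S l" by metis
    \<comment> \<open>Branch sets are disjoint, so distinct bad indices need distinct
      out-neighbours. There are at most \<open>2r + 2\<close> spoke vertices, each with at most
      \<open>d\<close> out-neighbours.\<close>
    have "inj_on g (bad i j)"
    proof (rule inj_onI, rule ccontr)
      fix k l assume kl: "k \<in> bad i j" "l \<in> bad i j" "g k = g l" "k \<noteq> l"
      then have "S k \<inter> S l = {}" by (intro S_disj) (auto simp: bad_def)
      then show False using g[OF kl(1)] g[OF kl(2)] kl(3) by auto
    qed
    moreover have "g ` bad i j \<subseteq> ?M" using g by blast
    moreover have "finite ?M" using fin out(1) by blast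
    ultimately have "card (bad i j) \<le> card ?M" by (rule card_inj_on_le)
    also have "\<dots> \<le> (\<Sum>v\<in>P i j \<union> Q i j. card (out v))" using fin by (intro card_UN_le) auto
    also have "\<dots> \<le> card (P i j \<union> Q i j) * d"
      using out(2) by (intro order.trans[OF sum_bounded_above[where K = d]]) auto
    also have "card (P i j \<union> Q i j) \<le> 2 * r + 2"
      using card_Un_le[of "P i j" "Q i j"] PQ[OF ij] by (auto simp: spoke_def)
    finally show ?thesis by (simp add: mult_right_mono)
  qed

  have sparse: "real (card {(i, j) \<in> D. {i, j} \<subseteq> X \<and> bad i j \<inter> X = {}}) \<le> t * real (card X)"
    if X: "X \<subseteq> V" for X
  proof (rule card_region_edges_le[OF \<G> t H])
    let ?F = "{(i, j) \<in> D. {i, j} \<subseteq> X \<and> bad i j \<inter> X = {}}"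
    have nb: "((i, j) \<in> D \<or> (j, i) \<in> D) \<and> i \<in> X \<and> j \<in> X" if "j \<in> neighbours ?F i" for i j
      using that by (auto simp: neighbours_def)
    \<comment> \<open>For a surviving edge, arcs leaving its spokes reach no sampled branch set
      other than its own two.\<close>
    have good: "l = i \<or> l = j"
      if "j \<in> neighbours ?F i" "v \<in> T i j" "w \<in> out v" "w \<in> S l" "l \<in> X" for i j l v w
    proof -
      have "(i, j) \<in> ?F \<or> (j, i) \<in> ?F" using that(1) by (simp add: neighbours_def)
      then show ?thesis
      proof
        assume ij: "(i, j) \<in> ?F"
        then have "l \<notin> bad i j" "v \<in> P i j" using that(2,5) D[of i j] by (auto simp: T_def)
        then show ?thesis using that(3-5) X by (auto simp: bad_def)
      next
        assume ij: "(j, i) \<in> ?F"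
        then have "l \<notin> bad j i" "v \<in> Q j i" using that(2,5) D[of j i] by (auto simp: T_def)
        then show ?thesis using that(3-5) X by (auto simp: bad_def)
      qed
    qed
    show "B i \<subseteq> pverts H" for i
    proof (cases "i \<in> V")
      case True
      then show ?thesis using A S_sub[OF True] unfolding B_def region_def by auto
    qed (simp add: B_def)
    show "finite X" using X V finite_subset by blast
    show "i \<in> X \<and> j \<in> X \<and> i < j" if "(i, j) \<in> ?F" for i j using that D by auto
    show "connected_in (parcs H) (region (T i j)) \<and> h i \<in> region (T i j) \<and> region (T i j) \<subseteq> B i"
      if "j \<in> neighbours ?F i" for i j
    proof -
      have i: "spoke i (c i) (T i j)" "i \<in> V" using nb[OF that] T by blast+
      then have "region (T i j) \<subseteq> B i" by (auto simp: spoke_def region_def B_def)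
      then show ?thesis using region_connected[OF i(2,1)] h_region[OF i(2,1)] by (simp add: E_def)
    qed
    show "\<exists>x\<in>region (T i j) \<inter> region (T j i). x = h i \<or>
        (\<exists>z\<in>component (parcs H) (region (T i j) - B j) (h i). (z, x) \<in> parcs H)"
      if "(i, j) \<in> ?F" for i j
    proof -
      have "(i, j) \<in> D" using that by simp
      then show ?thesis using contact[of i j] D[of i j] by (simp add: T_def E_def)
    qed
    show "a = j \<or> b = i" if "i \<noteq> j" and a: "a \<in> neighbours ?F i" and b: "b \<in> neighbours ?F j"
      and meet: "region (T i a) \<inter> region (T j b) \<noteq> {}" for i j a b
    proof -
      obtain v w where vw: "v \<in> T i a" "w \<in> T j b" "A v \<inter> A w \<noteq> {}"
        using meet by (auto simp: region_def)
      have X: "i \<in> X" "j \<in> X" and ij: "i \<in> V" "j \<in> V" and S: "v \<in> S i" "w \<in> S j"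
        using nb[OF a] nb[OF b] T[of i a] T[of j b] vw by (auto simp: spoke_def)
      \<comment> \<open>Overlapping regions of distinct vertices give an edge of \<open>G\<close>.
        If it is oriented from \<open>v\<close> to \<open>w\<close>, then \<open>good\<close> forces
        \<open>j = a\<close>; otherwise it forces \<open>i = b\<close>.\<close>
      have "v \<noteq> w" using S S_disj[OF ij \<open>i \<noteq> j\<close>] by blast
      then have "(v, w) \<in> parcs G" using A_meet[of v w] S S_sub ij vw(3) by blast
      then have "w \<in> out v \<or> v \<in> out w" by (rule oriented)
      then show ?thesis
        using good[OF a vw(1) _ S(2) X(2)] good[OF b vw(2) _ S(1) X(1)] \<open>i \<noteq> j\<close> by blast
    qed
  qed

  have "card (edges J) \<le> card D"
  proof -
    have "{u, v} \<in> (\<lambda>(i, j). {i, j}) ` D" if uv: "(u, v) \<in> parcs J" for u v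
    proof (cases "u < v")
      case True
      then show ?thesis using uv by (auto simp: D_def image_iff)
    next
      case False
      then have "(v, u) \<in> D"
        using uv irrJ symD[OF symJ uv] by (auto simp: D_def irrefl_def not_less le_less)
      then show ?thesis by (auto simp: image_iff insert_commute)
    qed
    then have "edges J \<subseteq> (\<lambda>(i, j). {i, j}) ` D" by (auto simp: edges_def)
    moreover have "finite D" by (rule finite_subset[of _ "V \<times> V"]) (use D V in auto)
    ultimately show ?thesis by (rule surj_card_le[rotated])
  qed
  also have "real (card D) \<le> exp 1 * t * (real ((2 * r + 2) * d) + 1) * real (card V)"
  proof (rule card_edges_le_by_sampling[OF V _ _ _ sparse])
    show "bad i j \<subseteq> V - {i, j} \<and> card (bad i j) \<le> (2 * r + 2) * d" if "(i, j) \<in> D" for i j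
      using card_bad[OF that] by (auto simp: bad_def)
  qed (use t D in auto)
  finally show ?thesis by (simp add: V_def)
qed

theorem theorem4:
  fixes d r :: nat and t :: real
    and \<G> :: "nat pair_pre_digraph set"
    and G :: "'a pair_pre_digraph"
  assumes "t \<ge> 1"
    and "graph_class \<G>"
    and "minor_closed \<G>"
    and "\<forall>H\<in>\<G>. edge_density H \<le> t"
    and "pair_graph G"
    and "region_intersection_graph_over G \<G>"
    and "max_density G \<le> real d"
  shows "nabla r G \<le> exp 1 * t * ((2 * real r + 2) * real d + 1)"
proof -
  obtain J :: "nat pair_pre_digraph" where J: "pair_graph J" "shallow_minor r J G"
    and nabla: "nabla r G = edge_density J"
    using nabla_attained[OF assms(5), of r] by blast
  show ?thesis
  \<comment> \<open>The null graph has density 0 by convention and is treated apart from the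
    division.\<close>
  proof (cases "pverts J = {}")
    case True
    then show ?thesis using assms(1) by (simp add: nabla edge_density_def)
  next
    case False
    have "card (pverts J) > 0" using J(1) False by (simp add: pair_graph_iff card_gt_0_iff)
    moreover have "real (card (edges J)) \<le>
        exp 1 * t * ((2 * real r + 2) * real d + 1) * real (card (pverts J))"
      using card_edges_shallow_minor_le[OF assms(2-4,1,5-7) J]
      by (simp only: of_nat_mult of_nat_add of_nat_numeral)
    ultimately show ?thesis
      using False by (simp add: nabla edge_density_def pos_divide_le_eq)
  qed
qed

end
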